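(* Let $n\ge4$, let $\underline{i}=(i_1,\ldots,i_n)$ be a rearrangement of $(1,2,\ldots,n)$, and let $k\in\mathbb Z$. For any field $\Bbbk$ of characteristic distinct from $2$, there exists $j\in\mathbb Z$ such that $$H^{2j+1}\big(\mathrm{BS}_c(\mathbf d(\underline{i})[k],1),\Bbbk\big)\ne0.$$
   Context: Let $\mathcal C=\mathrm{SU}_n$ and let $\mathcal K\subset\mathcal C$ be the maximal torus of diagonal matrices. The Weyl group is $W=S_n$, its reflections are the transpositions. For a transposition $t=(p\,q)$ with $p<q$, let $\phi_t:\mathrm{SU}_2\to\mathrm{SU}_n$ be the embedding placing a $2\times2$ matrix into rows and columns $p,q$ (identity elsewhere), and let $\mathcal C_t=\phi_t(\mathrm{SU}_2)\mathcal K$. For a sequence $\underline t=(t_1,\ldots,t_m)$ of transpositions, the compactly defined Bott-Samelson variety is $$\mathrm{BS}_c(\underline t)=\mathcal C_{t_1}\times\cdots\times\mathcal C_{t_m}/\mathcal K^m,$$ with right action $(c_1,\ldots,c_m)(k_1,\ldots,k_m)=(c_1k_1,k_1^{-1}c_2k_2,\ldots,k_{m-1}^{-1}c_mk_m)$. Let $\pi_c(\underline t):\mathrm{BS}_c(\underline t)\to\mathcal C/\mathcal K$, $[c_1,\ldots,c_m]\mapsto c_1c_2\cdots c_m\mathcal K$. For $w\in W$, $w\mathcal K$ denotes the corresponding $\mathcal K$-fixed point of $\mathcal C/\mathcal K$, and $\mathrm{BS}_c(\underline t,w)=\pi_c(\underline t)^{-1}(w\mathcal K)$; in particular $\mathrm{BS}_c(\underline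 t,1)$ is the fibre over $1\mathcal K$. For $\underline i=(i_1,\ldots,i_n)$ define the sequence of $2n-1$ transpositions $$\mathbf d(\underline i)=\big((i_1i_2),(i_1i_3),\ldots,(i_1i_n),\;(i_1i_2),(i_2i_3),\ldots,(i_{n-1}i_n),(i_ni_1)\big).$$ For a sequence $\underline t$ of length $m$, extended $m$-periodically to indices in $\mathbb Z$, the cyclic shift $\underline t[k]$ is defined by $(\underline t[k])_i=t_{k+i}$. *)

theory Defs
  imports "HOL-Analysis.Analysis" "HOL-Homology.Homology" "HOL-Combinatorics.Transposition"
begin

section \<open>Singular cohomology with coefficients\<close>

definition additive_group :: "'k::ab_group_add monoid"
  where "additive_group = \<lparr>carrier = UNIV, monoid.mult = (+), one = 0\<rparr>"

definition cochain_group :: "nat \<Rightarrow> 'a topology \<Rightarrow> 'g monoid \<Rightarrow> ('a chain \<Rightarrow> 'g) monoid"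
  where "cochain_group p X G =
    \<lparr>carrier = hom (chain_group p X) G \<inter> extensional (singular_chain_set p X),
     monoid.mult = (\<lambda>f g. \<lambda>c\<in>singular_chain_set p X. f c \<otimes>\<^bsub>G\<^esub> g c),
     one = (\<lambda>c\<in>singular_chain_set p X. \<one>\<^bsub>G\<^esub>)\<rparr>"

definition coboundary_map ::
    "nat \<Rightarrow> 'a topology \<Rightarrow> ('a chain \<Rightarrow> 'g) \<Rightarrow> ('a chain \<Rightarrow> 'g)"
  where "coboundary_map p X f = (\<lambda>c\<in>singular_chain_set p X. f (chain_boundary p c))"

definition cocycle_set :: "nat \<Rightarrow> 'a topology \<Rightarrow> 'g monoid \<Rightarrow> ('a chain \<Rightarrow> 'g) set"
  where "cocycle_set p X G =
    {f \<in> carrier (cochain_group p X G).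
       coboundary_map (Suc p) X f = \<one>\<^bsub>cochain_group (Suc p) X G\<^esub>}"

(* For p = 0 this is trivial, because chain_boundary 0 is the zero map. *)
definition coboundary_set :: "nat \<Rightarrow> 'a topology \<Rightarrow> 'g monoid \<Rightarrow> ('a chain \<Rightarrow> 'g) set"
  where "coboundary_set p X G = coboundary_map p X ` carrier (cochain_group (p - Suc 0) X G)"

definition cocycle_group :: "nat \<Rightarrow> 'a topology \<Rightarrow> 'g monoid \<Rightarrow> ('a chain \<Rightarrow> 'g) monoid"
  where "cocycle_group p X G = (cochain_group p X G)\<lparr>carrier := cocycle_set p X G\<rparr>"

(* Indexed by all integers and trivial in negative degrees, like the library's
   relative_homology_group. *)
definition cohomology_group ::
    "int \<Rightarrow> 'a topology \<Rightarrow> 'g monoid \<Rightarrow> ('a chain \<Rightarrow> 'g) set monoid"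
  where "cohomology_group p X G =
    (if p < 0 then singleton_group undefined
     else cocycle_group (nat p) X G Mod coboundary_set (nat p) X G)"

lemma comm_group_additive_group: "comm_group additive_group"
proof (rule comm_groupI)
  fix x :: 'a assume "x \<in> carrier additive_group"
  show "\<exists>y\<in>carrier additive_group. y \<otimes>\<^bsub>additive_group\<^esub> x = \<one>\<^bsub>additive_group\<^esub>"
    by (rule bexI [of _ "- x"]) (auto simp: additive_group_def)
qed (auto simp: additive_group_def algebra_simps)

lemma singular_chain_boundary':
  "singular_chain (Suc p) X c \<Longrightarrow> singular_chain p X (chain_boundary (Suc p) c)"
  using singular_chain_boundary [of "Suc p" X c] by simp

lemma cochain_iff:
  "f \<in> carrier (cochain_group p X G) \<longleftrightarrow>
     f \<in> extensional (singular_chain_set p X) \<and>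
     (\<forall>c. singular_chain p X c \<longrightarrow> f c \<in> carrier G) \<and>
     (\<forall>c d. singular_chain p X c \<longrightarrow> singular_chain p X d \<longrightarrow> f (c + d) = f c \<otimes>\<^bsub>G\<^esub> f d)"
  by (auto simp: cochain_group_def hom_def)

lemma comm_group_cochain_group:
  assumes "comm_group G"
  shows "comm_group (cochain_group p X G)"
proof -
  interpret G: comm_group G by fact
  let ?C = "cochain_group p X G"
  show ?thesis
  proof (rule comm_groupI)
    fix f g assume f: "f \<in> carrier ?C" and g: "g \<in> carrier ?C"
    show "f \<otimes>\<^bsub>?C\<^esub> g \<in> carrier ?C"
      using f g unfolding cochain_iff
      by (simp add: cochain_group_def singular_chain_add G.m_ac)
    show "f \<otimes>\<^bsub>?C\<^esub> g = g \<otimes>\<^bsub>?C\<^esub> f"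
      using f g unfolding cochain_iff
      by (auto simp: cochain_group_def fun_eq_iff G.m_comm)
    fix h assume h: "h \<in> carrier ?C"
    show "f \<otimes>\<^bsub>?C\<^esub> g \<otimes>\<^bsub>?C\<^esub> h = f \<otimes>\<^bsub>?C\<^esub> (g \<otimes>\<^bsub>?C\<^esub> h)"
      using f g h unfolding cochain_iff
      by (simp add: cochain_group_def fun_eq_iff G.m_assoc)
  next
    show "\<one>\<^bsub>?C\<^esub> \<in> carrier ?C"
      unfolding cochain_iff by (auto simp: cochain_group_def singular_chain_add)
  next
    fix f assume f: "f \<in> carrier ?C"
    then show "\<one>\<^bsub>?C\<^esub> \<otimes>\<^bsub>?C\<^esub> f = f"
      unfolding cochain_iff by (auto simp: cochain_group_def fun_eq_iff extensional_def)
    show "\<exists>g\<in>carrier ?C. g \<otimes>\<^bsub>?C\<^esub> f = \<one>\<^bsub>?C\<^esub>"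
    proof
      show "(\<lambda>c\<in>singular_chain_set p X. inv\<^bsub>G\<^esub> f c) \<in> carrier ?C"
        using f unfolding cochain_iff by (auto simp: singular_chain_add G.inv_mult)
      show "(\<lambda>c\<in>singular_chain_set p X. inv\<^bsub>G\<^esub> f c) \<otimes>\<^bsub>?C\<^esub> f = \<one>\<^bsub>?C\<^esub>"
        using f unfolding cochain_iff by (auto simp: cochain_group_def fun_eq_iff)
    qed
  qed
qed

lemma group_cochain_group:
  "comm_group G \<Longrightarrow> Group.group (cochain_group p X G)"
  by (rule comm_group.axioms(2) [OF comm_group_cochain_group])

lemma coboundary_map_hom:
  assumes "comm_group G"
  shows "coboundary_map (Suc p) X \<in> hom (cochain_group p X G) (cochain_group (Suc p) X G)"
proof (rule homI)
  fix f assume f: "f \<in> carrier (cochain_group p X G)"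
  then show "coboundary_map (Suc p) X f \<in> carrier (cochain_group (Suc p) X G)"
    unfolding cochain_iff
    by (auto simp: coboundary_map_def singular_chain_add chain_boundary_add singular_chain_boundary')
qed (auto simp: coboundary_map_def cochain_group_def fun_eq_iff singular_chain_boundary')

lemma cocycle_set_eq_kernel:
  "cocycle_set p X G =
     kernel (cochain_group p X G) (cochain_group (Suc p) X G) (coboundary_map (Suc p) X)"
  by (simp add: cocycle_set_def kernel_def)

lemma subgroup_cocycle_set:
  assumes "comm_group G"
  shows "subgroup (cocycle_set p X G) (cochain_group p X G)"
proof -
  interpret group_hom "cochain_group p X G" "cochain_group (Suc p) X G" "coboundary_map (Suc p) X"
    by (simp add: group_hom_def group_hom_axioms_def assms group_cochain_group coboundary_map_hom)
  show ?thesis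
    unfolding cocycle_set_eq_kernel by (rule subgroup_kernel)
qed

lemma cochain_zero:
  assumes "comm_group G" and f: "f \<in> carrier (cochain_group p X G)"
  shows "f 0 = \<one>\<^bsub>G\<^esub>"
proof -
  interpret G: comm_group G by fact
  have "f (0 + 0) = f 0 \<otimes>\<^bsub>G\<^esub> f 0" and "f 0 \<in> carrier G"
    using f unfolding cochain_iff by (metis singular_chain_0)+
  then show ?thesis
    by (simp add: G.r_cancel_one')
qed

lemma coboundary_set_0:
  assumes "comm_group G"
  shows "coboundary_set 0 X G = {\<one>\<^bsub>cochain_group 0 X G\<^esub>}"
proof -
  have "coboundary_map 0 X f = \<one>\<^bsub>cochain_group 0 X G\<^esub>"
    if "f \<in> carrier (cochain_group 0 X G)" for f
    using cochain_zero [OF assms that]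
    by (auto simp: coboundary_map_def chain_boundary_def cochain_group_def)
  moreover have "carrier (cochain_group 0 X G) \<noteq> {}"
    using group.is_monoid [OF group_cochain_group [OF assms]] monoid.one_closed by blast
  ultimately show ?thesis
    by (auto simp: coboundary_set_def)
qed

lemma subgroup_coboundary_set:
  assumes "comm_group G"
  shows "subgroup (coboundary_set p X G) (cochain_group p X G)"
proof (cases p)
  case 0
  then show ?thesis
    by (simp add: coboundary_set_0 group.triv_subgroup group_cochain_group assms)
next
  case (Suc q)
  interpret group_hom "cochain_group q X G" "cochain_group (Suc q) X G" "coboundary_map (Suc q) X"
    by (simp add: group_hom_def group_hom_axioms_def assms group_cochain_group coboundary_map_hom)
  show ?thesis
    using img_is_subgroup Suc by (simp add: coboundary_set_def)
qed

lemma coboundary_set_subset_cocycle_set: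
  assumes "comm_group G"
  shows "coboundary_set p X G \<subseteq> cocycle_set p X G"
proof
  fix f assume f: "f \<in> coboundary_set p X G"
  then obtain g where g: "g \<in> carrier (cochain_group (p - Suc 0) X G)"
    and fg: "f = coboundary_map p X g"
    by (auto simp: coboundary_set_def)
  have "f \<in> carrier (cochain_group p X G)"
    using f subgroup_coboundary_set [OF assms] subgroup.subset by blast
  moreover have "coboundary_map (Suc p) X f = \<one>\<^bsub>cochain_group (Suc p) X G\<^esub>"
    using cochain_zero [OF assms g] chain_boundary_boundary [of "Suc p" X]
    by (auto simp: fg coboundary_map_def cochain_group_def fun_eq_iff singular_chain_boundary')
  ultimately show "f \<in> cocycle_set p X G"
    by (simp add: cocycle_set_def)
qed

lemma comm_group_cocycle_group:
  assumes "comm_group G"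
  shows "comm_group (cocycle_group p X G)"
proof (rule group.group_comm_groupI)
  show "Group.group (cocycle_group p X G)"
    unfolding cocycle_group_def
    by (rule subgroup.subgroup_is_group [OF subgroup_cocycle_set [OF assms]
          group_cochain_group [OF assms]])
next
  fix f g assume "f \<in> carrier (cocycle_group p X G)" "g \<in> carrier (cocycle_group p X G)"
  then have "f \<in> carrier (cochain_group p X G)" "g \<in> carrier (cochain_group p X G)"
    by (simp_all add: cocycle_group_def cocycle_set_def)
  then show "f \<otimes>\<^bsub>cocycle_group p X G\<^esub> g = g \<otimes>\<^bsub>cocycle_group p X G\<^esub> f"
    using comm_monoid.m_comm [OF comm_group.axioms(1) [OF comm_group_cochain_group [OF assms]]]
    by (simp add: cocycle_group_def)
qed

lemma coboundary_set_normal: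
  assumes "comm_group G"
  shows "coboundary_set p X G \<lhd> cocycle_group p X G"
proof -
  have "subgroup (coboundary_set p X G) (cocycle_group p X G)"
    unfolding cocycle_group_def
    by (rule group.subgroup_incl [OF group_cochain_group [OF assms]
          subgroup_coboundary_set [OF assms] subgroup_cocycle_set [OF assms]
          coboundary_set_subset_cocycle_set [OF assms]])
  then show ?thesis
    by (simp add: comm_group.normal_iff_subgroup [OF comm_group_cocycle_group [OF assms]])
qed

lemma group_cohomology_group:
  assumes "comm_group G"
  shows "Group.group (cohomology_group p X G)"
  by (simp add: cohomology_group_def normal.factorgroup_is_group coboundary_set_normal [OF assms])


section \<open>Quotient topology\<close>

definition quotient_topology :: "'a topology \<Rightarrow> ('a \<Rightarrow> 'b) \<Rightarrow> 'b topology"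
  where "quotient_topology X f =
    topology (\<lambda>U. U \<subseteq> f ` topspace X \<and> openin X {x \<in> topspace X. f x \<in> U})"

lemma openin_quotient_topology:
  "openin (quotient_topology X f) U \<longleftrightarrow>
     U \<subseteq> f ` topspace X \<and> openin X {x \<in> topspace X. f x \<in> U}"
proof -
  have "istopology (\<lambda>U. U \<subseteq> f ` topspace X \<and> openin X {x \<in> topspace X. f x \<in> U})"
    unfolding istopology_def
  proof (intro conjI allI impI)
    fix S T assume "S \<subseteq> f ` topspace X \<and> openin X {x \<in> topspace X. f x \<in> S}"
      and "T \<subseteq> f ` topspace X \<and> openin X {x \<in> topspace X. f x \<in> T}"
    moreover have "{x \<in> topspace X. f x \<in> S \<inter> T} =
        {x \<in> topspace X. f x \<in> S} \<inter> {x \<in> topspace X. f x \<in> T}" by auto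
    ultimately show "S \<inter> T \<subseteq> f ` topspace X" "openin X {x \<in> topspace X. f x \<in> S \<inter> T}"
      by auto
  next
    fix \<K> assume *: "\<forall>K\<in>\<K>. K \<subseteq> f ` topspace X \<and> openin X {x \<in> topspace X. f x \<in> K}"
    then show "\<Union>\<K> \<subseteq> f ` topspace X" by blast
    have "{x \<in> topspace X. f x \<in> \<Union>\<K>} = (\<Union>K\<in>\<K>. {x \<in> topspace X. f x \<in> K})" by auto
    then show "openin X {x \<in> topspace X. f x \<in> \<Union>\<K>}" using * by auto
  qed
  then show ?thesis
    by (simp add: quotient_topology_def)
qed

lemma topspace_quotient_topology [simp]: "topspace (quotient_topology X f) = f ` topspace X"
proof
  show "topspace (quotient_topology X f) \<subseteq> f ` topspace X"
    using openin_topspace [of "quotient_topology X f"] by (simp only: openin_quotient_topology)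
  have "{x \<in> topspace X. f x \<in> f ` topspace X} = topspace X" by auto
  then have "openin (quotient_topology X f) (f ` topspace X)"
    by (simp add: openin_quotient_topology)
  then show "f ` topspace X \<subseteq> topspace (quotient_topology X f)"
    by (rule openin_subset)
qed

lemma quotient_map_quotient_topology: "quotient_map X (quotient_topology X f) f"
  by (auto simp: quotient_map_def openin_quotient_topology)


section \<open>Compactly defined Bott-Samelson varieties\<close>

type_synonym 'n cmat = "((complex, 'n) vec, 'n) vec"

definition conj_transpose :: "'n::finite cmat \<Rightarrow> 'n cmat"
  where "conj_transpose A = (\<chi> i j. cnj (A $ j $ i))"

definition SU :: "('n::finite cmat) set"
  where "SU = {A. A ** conj_transpose A = mat 1 \<and> det A = 1}"

definition torus :: "('n::finite cmat) set"
  where "torus = {A \<in> SU. \<forall>i j. i \<noteq> j \<longrightarrow> A $ i $ j = 0}"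

definition embed2 :: "'n::finite \<Rightarrow> 'n \<Rightarrow> 2 cmat \<Rightarrow> 'n cmat"
  where "embed2 p q A = (\<chi> i j.
    if i \<in> {p, q} \<and> j \<in> {p, q}
    then A $ (if i = p then 1 else 2) $ (if j = p then 1 else 2)
    else if i = j then 1 else 0)"

(* The reflection t is a permutation of the index type; for a transposition the
   pair p < q is determined by t. *)
definition C_refl :: "('n::{finite,linorder} \<Rightarrow> 'n) \<Rightarrow> ('n cmat) set"
  where "C_refl t = {embed2 p q A ** K | p q A K.
    p < q \<and> t = Transposition.transpose p q \<and> A \<in> SU \<and> K \<in> torus}"

(* A sequence (c_1, ..., c_m) is an extensional function on {..<m}, c_r being its value
   at r - 1. *)
definition BS_product :: "('n::{finite,linorder} \<Rightarrow> 'n) list \<Rightarrow> (nat \<Rightarrow> 'n cmat) topology"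
  where "BS_product ts =
    product_topology (\<lambda>r. subtopology euclidean (C_refl (ts ! r))) {..<length ts}"

definition torus_act ::
    "nat \<Rightarrow> (nat \<Rightarrow> 'n::finite cmat) \<Rightarrow> (nat \<Rightarrow> 'n cmat) \<Rightarrow> (nat \<Rightarrow> 'n cmat)"
  where "torus_act m c k = (\<lambda>r\<in>{..<m}.
    if r = 0 then c r ** k r else matrix_inv (k (r - 1)) ** c r ** k r)"

definition torus_orbit ::
    "nat \<Rightarrow> (nat \<Rightarrow> 'n::finite cmat) \<Rightarrow> (nat \<Rightarrow> 'n cmat) set"
  where "torus_orbit m c = torus_act m c ` (\<Pi>\<^sub>E r\<in>{..<m}. torus)"

definition BS :: "('n::{finite,linorder} \<Rightarrow> 'n) list \<Rightarrow> (nat \<Rightarrow> 'n cmat) set topology"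
  where "BS ts = quotient_topology (BS_product ts) (torus_orbit (length ts))"

definition torus_coset :: "'n::finite cmat \<Rightarrow> ('n cmat) set"
  where "torus_coset A = (\<lambda>K. A ** K) ` torus"

(* The coset of c_1 ** ... ** c_m is the same for all c in an orbit. *)
definition BS_proj :: "nat \<Rightarrow> (nat \<Rightarrow> 'n::finite cmat) set \<Rightarrow> ('n cmat) set"
  where "BS_proj m x =
    the_elem ((\<lambda>c. torus_coset (foldr (\<lambda>r B. c r ** B) [0..<m] (mat 1))) ` x)"

definition BS_fibre ::
    "('n::{finite,linorder} \<Rightarrow> 'n) list \<Rightarrow> ('n cmat) set
       \<Rightarrow> (nat \<Rightarrow> 'n cmat) set topology"
  where "BS_fibre ts y =
    subtopology (BS ts) {x \<in> topspace (BS ts). BS_proj (length ts) x = y}"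

definition BS_one :: "('n::{finite,linorder} \<Rightarrow> 'n) list \<Rightarrow> (nat \<Rightarrow> 'n cmat) set topology"
  where "BS_one ts = BS_fibre ts (torus_coset (mat 1))"

(* A list is indexed from 0, so i_j is ns ! (j - 1). *)
definition d_seq :: "'n list \<Rightarrow> ('n \<Rightarrow> 'n) list"
  where "d_seq ns =
    map (\<lambda>j. Transposition.transpose (ns ! 0) (ns ! j)) [1..<length ns]
    @ map (\<lambda>j. Transposition.transpose (ns ! j) (ns ! Suc j)) [0..<length ns - 1]
    @ [Transposition.transpose (ns ! (length ns - 1)) (ns ! 0)]"

definition cyclic_shift :: "'b list \<Rightarrow> int \<Rightarrow> 'b list"
  where "cyclic_shift ts k =
    map (\<lambda>r. ts ! nat ((int r + k) mod int (length ts))) [0..<length ts]"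

end

theory Submission
  imports Defs "HOL-Complex_Analysis.Winding_Numbers"
begin

text \<open>
  The odd degree is 1: there is a map from the fibre to the punctured plane and a loop in the fibre
  whose image goes once around the origin. Pulling back the generator of the first cohomology of the
  punctured plane gives a class that takes the value 1 on the loop, with any nontrivial ring of
  coefficients.

  A point of the fibre is represented by matrices whose product lies in the torus. The absolute
  values of the entries of these matrices do not depend on the representative. Let \<open>u\<close> and \<open>w\<close> be the squared
  absolute values of an off-diagonal entry of the factor of the first star edge \<open>(i\<^sub>1 i\<^sub>2)\<close> and of the factor
  of the closing edge \<open>(i\<^sub>n i\<^sub>1)\<close>. They define a map to the unit square. The point is that this map
  avoids the centre of the square (\<open>not_both_half\<close>): if all entries in the blocks of these two factors are
  nonzero, then the equation that the product is 1 cannot hold, because the remaining star factors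
  would have to multiply to a matrix with too many zeros.

  The loop consists of rotations by real angles (\<open>matprod_up\<close>, \<open>matprod_turn\<close>, \<open>matprod_down\<close>,
  \<open>matprod_last\<close>). At its corners every angle is 0 or a quarter turn up to sign, that is, the
  corners are torus fixed points, and there are \<open>2 n - 1\<close> segments between them. Along the loop the
  point \<open>(u, w)\<close> runs once through the boundary of the square.

  A cyclic shift of the sequence does not matter: a factorization of the identity can be rotated, which
  changes neither the absolute values of entries nor the product. The fibre of the shifted sequence is
  a quotient by a different action, but only these absolute values and the loop are used.

  The cocycle is built directly on singular simplices. It counts the crossings of a path with the
  negative real axis (\<open>crossings\<close>), it is closed because crossing numbers are additive over a triangle, and
  \<open>nontrivial_H1_if_circling\<close> evaluates it on a loop that visits four half planes in turn.\<close>

section \<open>Cohomology classes detected by a cycle\<close>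

lemma cochain_hom_sum:
  fixes h :: "'a chain \<Rightarrow> 'k::comm_ring_1"
  assumes h: "h \<in> hom (chain_group p X) additive_group"
    and "finite I" and c: "\<And>i. i \<in> I \<Longrightarrow> singular_chain p X (c i)"
  shows "h (\<Sum>i\<in>I. frag_cmul ((-1) ^ e i) (c i)) = (\<Sum>i\<in>I. (-1) ^ e i * h (c i))"
proof -
  have add: "h (a + b) = h a + h b" if "singular_chain p X a" "singular_chain p X b" for a b
    using h that by (simp add: hom_def additive_group_def)
  have zero: "h 0 = 0"
    using add [of 0 0] by simp
  have neg: "h (- a) = - h a" if "singular_chain p X a" for a
    using add [of a "- a"] that by (simp add: zero singular_chain_minus eq_neg_iff_add_eq_0 add.commute)
  have one: "h (frag_cmul ((-1) ^ k) a) = (-1) ^ k * h a" if "singular_chain p X a" for a k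
    using neg [OF that] by (cases "even k") simp_all
  show ?thesis
    using \<open>finite I\<close> c
  proof (induction I rule: finite_induct)
    case (insert i I)
    have "singular_chain p X (\<Sum>i\<in>I. frag_cmul ((-1) ^ e i) (c i))"
      using insert by (intro singular_chain_sum singular_chain_cmul) auto
    with insert show ?case
      by (simp add: add one singular_chain_cmul)
  qed (simp add: zero)
qed

text \<open>A function on singular simplices extends to a cochain because the chain group is free on the
simplices. It is a cocycle if it kills the boundary of every simplex, and a coboundary vanishes
on every cycle.\<close>
lemma nontrivial_cohomology_if_cocycle_nonzero_on_cycle:
  fixes \<phi> :: "((nat \<Rightarrow> real) \<Rightarrow> 'a) \<Rightarrow> 'k::comm_ring_1" and N :: nat
  assumes closed: "\<And>\<sigma>. singular_simplex (Suc p) X \<sigma> \<Longrightarrow>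
            (\<Sum>k\<le>Suc p. (-1) ^ k * \<phi> (singular_face (Suc p) k \<sigma>)) = 0"
    and \<tau>: "\<And>i. i < N \<Longrightarrow> singular_simplex p X (\<tau> i)"
    and cycle: "chain_boundary p (\<Sum>i<N. frag_of (\<tau> i)) = 0"
    and nonzero: "(\<Sum>i<N. \<phi> (\<tau> i)) \<noteq> 0"
  shows "\<not> trivial_group (cohomology_group (int p) X (additive_group :: 'k monoid))"
proof
  let ?G = "additive_group :: 'k monoid" and ?z = "\<Sum>i<N. frag_of (\<tau> i)"
  assume trivial: "trivial_group (cohomology_group (int p) X ?G)"
  note G = comm_group_additive_group [where 'a = 'k]
  obtain h where h: "h \<in> hom (chain_group p X) ?G"
    and h_of: "\<And>\<sigma>. singular_simplex p X \<sigma> \<Longrightarrow> h (frag_of \<sigma>) = \<phi> \<sigma>"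
    using comm_group.free_Abelian_group_universal [OF G, of \<phi> "singular_simplex_set p X"]
    unfolding chain_group_def by (auto simp: additive_group_def)
  have add: "h (a + b) = h a + h b" if "singular_chain p X a" "singular_chain p X b" for a b
    using h that by (simp add: hom_def additive_group_def)
  have h_diff: "h (a - b) = h a - h b" if "singular_chain p X a" "singular_chain p X b" for a b
    using add [of "a - b" b] that by (simp add: singular_chain_diff eq_diff_eq)
  have zero: "h 0 = 0"
    using add [of 0 0] by simp
  have boundary: "singular_chain (Suc p) X c \<and> h (chain_boundary (Suc p) c) = 0"
    if "Poly_Mapping.keys c \<subseteq> singular_simplex_set (Suc p) X" for c
    using that
  proof (induction c rule: frag_induction)
    case (one \<sigma>)
    then have "singular_simplex p X (singular_face (Suc p) k \<sigma>)" if "k \<le> Suc p" for k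
      using singular_simplex_singular_face [of "Suc p" X \<sigma> k] that by simp
    with one closed [of \<sigma>] show ?case
      using cochain_hom_sum [OF h, of "{..Suc p}" "\<lambda>k. frag_of (singular_face (Suc p) k \<sigma>)" "\<lambda>k. k"]
      by (simp add: chain_boundary_of h_of singular_chain_of del: sum.atMost_Suc)
  next
    case (diff a b)
    then show ?case
      by (simp add: chain_boundary_diff singular_chain_diff h_diff singular_chain_boundary')
  qed (simp add: zero)
  define f where "f = restrict h (singular_chain_set p X)"
  have f_carrier: "f \<in> carrier (cochain_group p X ?G)"
    using add by (auto simp: f_def cochain_iff additive_group_def singular_chain_add)
  then have "f \<in> cocycle_set p X ?G"
    using boundary
    by (auto simp: f_def singular_chain_def [of "Suc p"] cocycle_set_def coboundary_map_def cochain_group_def additive_group_def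
        singular_chain_boundary')
  then have "coboundary_set p X ?G #>\<^bsub>cocycle_group p X ?G\<^esub> f \<in> carrier (cohomology_group (int p) X ?G)"
    by (auto simp: cohomology_group_def FactGroup_def RCOSETS_def cocycle_group_def)
  with trivial have "coboundary_set p X ?G #>\<^bsub>cocycle_group p X ?G\<^esub> f = coboundary_set p X ?G"
    by (auto simp: trivial_group_def cohomology_group_def)
  moreover have "f \<in> coboundary_set p X ?G #>\<^bsub>cocycle_group p X ?G\<^esub> f"
    using \<open>f \<in> cocycle_set p X ?G\<close> coboundary_set_normal [OF G]
    by (intro group.rcos_self comm_group.axioms(2) comm_group_cocycle_group G normal_imp_subgroup)
       (auto simp: cocycle_group_def)
  ultimately obtain g where g: "g \<in> carrier (cochain_group (p - Suc 0) X ?G)"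
    and fg: "f = coboundary_map p X g"
    by (auto simp: coboundary_set_def)
  have z: "singular_chain p X ?z"
    using \<tau> by (auto intro: singular_chain_sum simp: singular_chain_of)
  have "f ?z = (\<Sum>i<N. \<phi> (\<tau> i))"
    using cochain_hom_sum [OF h, of "{..<N}" "\<lambda>i. frag_of (\<tau> i)" "\<lambda>_. 0"] z \<tau>
    by (simp add: f_def h_of singular_chain_of)
  moreover have "f ?z = 0"
    using cochain_zero [OF G g] z by (simp add: fg coboundary_map_def cycle additive_group_def)
  ultimately show False
    using nonzero by simp
qed

section \<open>A degree one cocycle from a map to the punctured plane\<close>

text \<open>
  Along a path in the punctured plane the logarithm can be continued, and
  \<open>2 \<pi> \<i>\<close> times the winding number is its total change (for open paths as well). Subtracting the
  difference of the principal logarithms at the end points leaves an integer multiple of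
  \<open>2 \<pi> \<i>\<close>: the number of times the path crosses the negative real axis downwards, counted with sign.
  Unlike the total change itself, which is complex, this integer makes sense in every ring, so it
  gives a cochain with arbitrary coefficients.\<close>
definition log_defect :: "(real \<Rightarrow> complex) \<Rightarrow> complex"
  where "log_defect \<gamma> = winding_number \<gamma> 0 - (Ln (pathfinish \<gamma>) - Ln (pathstart \<gamma>)) / (2 * of_real pi * \<i>)"

definition crossings :: "(real \<Rightarrow> complex) \<Rightarrow> int"
  where "crossings \<gamma> = \<lfloor>Re (log_defect \<gamma>)\<rfloor>"

text \<open>The exponentials of both sides of the defining difference agree: the winding number of a path
recovers the quotient of its end points.\<close>
lemma of_int_crossings:
  assumes "path \<gamma>" "0 \<notin> path_image \<gamma>"
  shows "of_int (crossings \<gamma>) = log_defect \<gamma>"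
proof -
  have ends: "pathstart \<gamma> \<noteq> 0" "pathfinish \<gamma> \<noteq> 0"
    using assms by (metis pathstart_in_path_image, metis pathfinish_in_path_image)
  have "2 * of_real pi * \<i> * log_defect \<gamma> =
      2 * of_real pi * \<i> * winding_number \<gamma> 0 + Ln (pathstart \<gamma>) - Ln (pathfinish \<gamma>)"
    by (simp add: log_defect_def field_simps)
  then have "exp (2 * of_real pi * \<i> * log_defect \<gamma>) =
      exp (2 * of_real pi * \<i> * winding_number \<gamma> 0) * pathstart \<gamma> / pathfinish \<gamma>"
    using ends by (simp add: exp_add exp_diff)
  also have "\<dots> = 1"
    using winding_number_exp_2pi [OF assms] ends by simp
  finally have "log_defect \<gamma> \<in> \<int>"
    unfolding exp_eq_1 by (auto simp: complex_eq_iff complex_is_Int_iff)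
  then show ?thesis
    by (auto simp: crossings_def elim: Ints_cases)
qed

text \<open>In a convex set the path over two sides of a triangle is homotopic to the third side; the
principal logarithms cancel at the middle vertex.\<close>
lemma crossings_triangle:
  fixes F :: "'b::real_normed_vector \<Rightarrow> complex"
  assumes "convex S" and cont: "continuous_on S F" and nz: "\<And>z. z \<in> S \<Longrightarrow> F z \<noteq> 0"
    and abc: "a \<in> S" "b \<in> S" "c \<in> S"
  shows "crossings (F \<circ> linepath a b) + crossings (F \<circ> linepath b c) = crossings (F \<circ> linepath a c)"
proof -
  have seg: "path_image (linepath x y) \<subseteq> S" if "x \<in> S" "y \<in> S" for x y
    using that \<open>convex S\<close> by (simp add: closed_segment_subset)
  have path: "path (F \<circ> linepath x y)" if "x \<in> S" "y \<in> S" for x y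
    using seg [OF that] by (intro path_continuous_image continuous_on_subset [OF cont]) auto
  have avoid: "0 \<notin> path_image (F \<circ> linepath x y)" if "x \<in> S" "y \<in> S" for x y
    using seg [OF that] nz by (auto simp: path_image_compose)
  have "homotopic_paths S (linepath a b +++ linepath b c) (linepath a c)"
    using convex_imp_simply_connected [OF \<open>convex S\<close>] seg abc
    unfolding simply_connected_eq_homotopic_paths by (simp add: path_image_join)
  then have "homotopic_paths (- {0}) (F \<circ> (linepath a b +++ linepath b c)) (F \<circ> linepath a c)"
    using cont nz by (rule_tac homotopic_paths_continuous_image) auto
  then have "winding_number ((F \<circ> linepath a b) +++ (F \<circ> linepath b c)) 0 = winding_number (F \<circ> linepath a c) 0"
    by (metis path_compose_join winding_number_homotopic_paths)
  then have "winding_number (F \<circ> linepath a b) 0 + winding_number (F \<circ> linepath b c) 0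
      = winding_number (F \<circ> linepath a c) 0"
    using path avoid abc by (simp add: winding_number_join pathstart_compose pathfinish_compose)
  then have "log_defect (F \<circ> linepath a b) + log_defect (F \<circ> linepath b c) = log_defect (F \<circ> linepath a c)"
    by (simp add: log_defect_def pathstart_compose pathfinish_compose diff_divide_distrib)
  then have "(of_int (crossings (F \<circ> linepath a b) + crossings (F \<circ> linepath b c)) :: complex)
      = of_int (crossings (F \<circ> linepath a c))"
    using of_int_crossings path avoid abc by simp
  then show ?thesis
    by (simp only: of_int_eq_iff)
qed

lemma winding_number_eq_log_difference:
  assumes "path q" and "\<And>t. t \<in> {0..1} \<Longrightarrow> \<gamma> t = exp (q t)"
  shows "winding_number \<gamma> 0 = (pathfinish q - pathstart q) / (2 * of_real pi * \<i>)"
  using winding_number_compose_exp [OF \<open>path q\<close>] winding_number_cong [of \<gamma> "exp \<circ> q" 0] assms(2) by simp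

text \<open>Off the negative real axis the principal logarithm is itself the continued one.\<close>
lemma crossings_eq_0:
  assumes "path \<gamma>" and slit: "\<And>t. t \<in> {0..1} \<Longrightarrow> \<gamma> t \<notin> \<real>\<^sub>\<le>\<^sub>0"
  shows "crossings \<gamma> = 0"
proof -
  have "path (Ln \<circ> \<gamma>)"
    using assms by (intro path_continuous_image continuous_on_Ln) (auto simp: path_image_def)
  moreover have "\<gamma> t = exp ((Ln \<circ> \<gamma>) t)" if "t \<in> {0..1}" for t
    using slit [OF that] by (cases "\<gamma> t = 0") auto
  ultimately have "winding_number \<gamma> 0 = (pathfinish (Ln \<circ> \<gamma>) - pathstart (Ln \<circ> \<gamma>)) / (2 * of_real pi * \<i>)"
    by (rule winding_number_eq_log_difference)
  then show ?thesis
    by (simp add: crossings_def log_defect_def pathstart_compose pathfinish_compose)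
qed

text \<open>On the left half plane \<open>Ln (- z) + \<i> \<pi>\<close> is a continuous logarithm. It is the principal one above the
real axis and exceeds it by \<open>2 \<pi> \<i>\<close> below.\<close>
lemma crossings_eq_1:
  assumes "path \<gamma>" and left: "\<And>t. t \<in> {0..1} \<Longrightarrow> Re (\<gamma> t) < 0"
    and "Im (pathstart \<gamma>) > 0" "Im (pathfinish \<gamma>) < 0"
  shows "crossings \<gamma> = 1"
proof -
  let ?q = "\<lambda>t. Ln (- \<gamma> t) + \<i> * of_real pi"
  have "path ?q"
    unfolding path_def
  proof (intro continuous_intros continuous_on_Ln)
    show "- \<gamma> t \<notin> \<real>\<^sub>\<le>\<^sub>0" if "t \<in> {0..1}" for t
      using left [OF that] by (auto simp: complex_nonpos_Reals_iff)
  qed (use assms(1) in \<open>simp add: path_def\<close>)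
  moreover have "\<gamma> t = exp (?q t)" if "t \<in> {0..1}" for t
  proof -
    have "\<gamma> t \<noteq> 0"
      using left [OF that] by auto
    then show ?thesis
      by (simp add: exp_add)
  qed
  ultimately have wn: "winding_number \<gamma> 0 = (pathfinish ?q - pathstart ?q) / (2 * of_real pi * \<i>)"
    by (rule winding_number_eq_log_difference)
  have "Ln (- pathstart \<gamma>) = Ln (pathstart \<gamma>) - \<i> * of_real pi"
    using assms(3) by (subst Ln_minus) auto
  moreover have "Ln (- pathfinish \<gamma>) = Ln (pathfinish \<gamma>) + \<i> * of_real pi"
    using assms(4) by (subst Ln_minus) auto
  ultimately have "log_defect \<gamma> = 1"
    unfolding log_defect_def wn by (simp add: pathstart_def pathfinish_def field_simps)
  then show ?thesis
    by (simp add: crossings_def)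
qed

definition edge_point :: "real \<Rightarrow> nat \<Rightarrow> real"
  where "edge_point t = (\<lambda>i. if i = 0 then 1 - t else if i = 1 then t else 0)"

lemma standard_simplex_1: "standard_simplex 1 = edge_point ` {0..1}"
proof -
  have "x \<in> edge_point ` {0..1}" if "x \<in> standard_simplex 1" for x
  proof
    show "x = edge_point (x 1)" "x 1 \<in> {0..1}"
      using that by (auto simp: edge_point_def standard_simplex_def fun_eq_iff)
  qed
  then show ?thesis
    by (auto simp: edge_point_def standard_simplex_def)
qed

text \<open>The coordinate with index 1 runs from 0 to 1 along the edge from vertex 0 to vertex 1.\<close>
definition simplex_of_path :: "(real \<Rightarrow> 'a) \<Rightarrow> (nat \<Rightarrow> real) \<Rightarrow> 'a"
  where "simplex_of_path g = (\<lambda>x\<in>standard_simplex 1. g (x 1))"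

lemma simplex_of_path_edge_point: "t \<in> {0..1} \<Longrightarrow> simplex_of_path g (edge_point t) = g t"
  unfolding simplex_of_path_def standard_simplex_1 by (simp add: edge_point_def)

lemma singular_simplex_simplex_of_path:
  assumes "pathin X g"
  shows "singular_simplex 1 X (simplex_of_path g)"
proof -
  have "continuous_map (subtopology (powertop_real UNIV) (standard_simplex 1)) (top_of_set {0..1}) (\<lambda>x. x 1)"
    unfolding standard_simplex_1
    by (auto simp: continuous_map_in_subtopology edge_point_def
        intro: continuous_map_from_subtopology continuous_map_product_projection)
  from continuous_map_compose [OF this assms [unfolded pathin_def]]
  show ?thesis
    unfolding singular_simplex_def simplex_of_path_def
    by (auto elim!: continuous_map_eq)
qed

lemma chain_boundary_simplex_of_path:
  "chain_boundary 1 (frag_of (simplex_of_path g)) =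
    frag_of (\<lambda>x\<in>standard_simplex 0. g 1) - frag_of (\<lambda>x\<in>standard_simplex 0. g 0)"
proof -
  have "simplical_face 0 x = edge_point 1" "simplical_face 1 x = edge_point 0"
    if "x \<in> standard_simplex 0" for x
    using that by (auto simp: standard_simplex_0 simplical_face_def edge_point_def fun_eq_iff)
  then show ?thesis
    by (auto simp: chain_boundary_of singular_face_def o_def simplex_of_path_edge_point
        intro!: arg_cong2 [where f = "(-)"] arg_cong [where f = frag_of])
qed

text \<open>
  Affine coordinates on the standard 2-simplex, whose vertices correspond to 0, 1 and \<open>\<i>\<close>. They
  replace the function space of barycentric coordinates by a convex set in a normed space, where
  the theory of paths and homotopies is available.\<close>
definition triangle_point :: "complex \<Rightarrow> nat \<Rightarrow> real"
  where "triangle_point z = (\<lambda>i. if i = 0 then 1 - Re z - Im z else if i = 1 then Re z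
    else if i = 2 then Im z else 0)"

definition triangle :: "complex set"
  where "triangle = {z. 0 \<le> Re z \<and> 0 \<le> Im z \<and> Re z + Im z \<le> 1}"

lemma convex_triangle: "convex triangle"
proof -
  have eq: "triangle = {z. 0 \<le> Re z} \<inter> {z. 0 \<le> Im z} \<inter> {z. (1 + \<i>) \<bullet> z \<le> 1}"
    by (auto simp: triangle_def inner_complex_def)
  show ?thesis
    unfolding eq by (intro convex_Int convex_halfspace_Re_ge convex_halfspace_Im_ge convex_halfspace_le)
qed

lemma continuous_on_triangle:
  assumes "singular_simplex 2 X \<sigma>" and "continuous_map X euclidean f"
  shows "continuous_on triangle (f \<circ> \<sigma> \<circ> triangle_point)"
proof -
  have "triangle_point z \<in> standard_simplex 2" if "z \<in> triangle" for z
    using that by (auto simp: triangle_point_def triangle_def standard_simplex_def numeral_2_eq_2)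
  moreover have "continuous_on triangle (\<lambda>z. triangle_point z i)" for i
    by (cases "i = 0"; cases "i = 1"; cases "i = 2")
       (auto simp: triangle_point_def intro!: continuous_intros)
  ultimately have "continuous_map (top_of_set triangle)
      (subtopology (powertop_real UNIV) (standard_simplex 2)) triangle_point"
    by (auto simp: continuous_map_in_subtopology continuous_map_componentwise_UNIV)
  moreover have "continuous_map (subtopology (powertop_real UNIV) (standard_simplex 2)) euclidean (f \<circ> \<sigma>)"
    using assms unfolding singular_simplex_def by (auto intro: continuous_map_compose)
  ultimately have "continuous_map (top_of_set triangle) euclidean (f \<circ> \<sigma> \<circ> triangle_point)"
    by (rule continuous_map_compose)
  then show ?thesis
    by simp
qed

text \<open>The three faces of a singular 2-simplex are the sides of the triangle, so this is the additivity
of crossing numbers over a triangle.\<close>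
lemma crossings_cocycle:
  assumes \<sigma>: "singular_simplex (Suc 1) X \<sigma>" and f: "continuous_map X euclidean f"
    and nz: "\<And>x. x \<in> topspace X \<Longrightarrow> f x \<noteq> 0"
  shows "(\<Sum>k\<le>Suc 1. (-1) ^ k *
    (of_int (crossings (f \<circ> singular_face (Suc 1) k \<sigma> \<circ> edge_point)) :: 'k::comm_ring_1)) = 0"
proof -
  let ?F = "f \<circ> \<sigma> \<circ> triangle_point"
  have edge: "crossings (f \<circ> singular_face (Suc 1) k \<sigma> \<circ> edge_point) = crossings (?F \<circ> linepath a b)"
    if eq: "\<And>t. simplical_face k (edge_point t) = triangle_point (linepath a b t)" for k a b
  proof -
    have "(f \<circ> singular_face (Suc 1) k \<sigma> \<circ> edge_point) t = (?F \<circ> linepath a b) t" if "t \<in> {0..1}" for t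
      using that by (simp add: singular_face_def standard_simplex_1 [simplified] eq)
    then show ?thesis
      by (simp add: crossings_def log_defect_def pathstart_def pathfinish_def cong: winding_number_cong)
  qed
  have faces: "simplical_face 0 (edge_point t) = triangle_point (linepath 1 \<i> t)"
      "simplical_face 1 (edge_point t) = triangle_point (linepath 0 \<i> t)"
      "simplical_face 2 (edge_point t) = triangle_point (linepath 0 1 t)" for t
    by (auto simp: simplical_face_def edge_point_def triangle_point_def linepath_def fun_eq_iff)
  have "triangle_point z \<in> standard_simplex 2" if "z \<in> triangle" for z
    using that by (auto simp: triangle_point_def triangle_def standard_simplex_def numeral_2_eq_2)
  then have "?F z \<noteq> 0" if "z \<in> triangle" for z
    using \<sigma> nz that by (force simp: singular_simplex_def continuous_map_def numeral_2_eq_2)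
  then have "crossings (?F \<circ> linepath 0 1) + crossings (?F \<circ> linepath 1 \<i>) = crossings (?F \<circ> linepath 0 \<i>)"
    using \<sigma> f by (intro crossings_triangle [OF convex_triangle] continuous_on_triangle)
      (auto simp: triangle_def numeral_2_eq_2)
  then show ?thesis
    using edge [OF faces(1)] edge [OF faces(2)] edge [OF faces(3)]
    by (simp add: numeral_2_eq_2 algebra_simps flip: of_int_add)
qed

text \<open>The four arcs join up to a cycle whose image goes once around the origin through the four half
planes. The first three arcs avoid the negative real axis and the last one crosses it
downwards once more than upwards, so that the crossing cocycle takes the value 1 on the cycle. This value is nonzero in
every nontrivial ring of coefficients.\<close>
theorem nontrivial_H1_if_circling:
  assumes f: "continuous_map X euclidean f" and nz: "\<And>x. x \<in> topspace X \<Longrightarrow> f x \<noteq> 0"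
    and bottom: "path_component_of (subtopology X {x. Im (f x) < 0}) x0 x1"
    and right: "path_component_of (subtopology X {x. Re (f x) > 0}) x1 x2"
    and top: "path_component_of (subtopology X {x. Im (f x) > 0}) x2 x3"
    and left: "path_component_of (subtopology X {x. Re (f x) < 0}) x3 x0"
  shows "\<not> trivial_group (cohomology_group 1 X (additive_group :: 'k::comm_ring_1 monoid))"
proof -
  obtain p0 p1 p2 p3 where p:
      "pathin (subtopology X {x. Im (f x) < 0}) p0" "p0 0 = x0" "p0 1 = x1"
      "pathin (subtopology X {x. Re (f x) > 0}) p1" "p1 0 = x1" "p1 1 = x2"
      "pathin (subtopology X {x. Im (f x) > 0}) p2" "p2 0 = x2" "p2 1 = x3"
      "pathin (subtopology X {x. Re (f x) < 0}) p3" "p3 0 = x3" "p3 1 = x0"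
    using bottom right top left unfolding path_component_of_def by blast
  then have pX: "pathin X p0" "pathin X p1" "pathin X p2" "pathin X p3"
    and in_region: "\<And>t. t \<in> {0..1} \<Longrightarrow> Im (f (p0 t)) < 0" "\<And>t. t \<in> {0..1} \<Longrightarrow> Re (f (p1 t)) > 0"
      "\<And>t. t \<in> {0..1} \<Longrightarrow> Im (f (p2 t)) > 0" "\<And>t. t \<in> {0..1} \<Longrightarrow> Re (f (p3 t)) < 0"
    unfolding pathin_def continuous_map_in_subtopology by auto
  have path: "path (f \<circ> g)" if "pathin X g" for g
    using continuous_map_compose [OF that [unfolded pathin_def] f] by (simp add: path_def)
  have "crossings (f \<circ> p0) = 0" "crossings (f \<circ> p1) = 0" "crossings (f \<circ> p2) = 0"
    using in_region(1-3)
    by (intro crossings_eq_0 path pX; fastforce simp: complex_nonpos_Reals_iff)+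
  moreover have "crossings (f \<circ> p3) = 1"
    using in_region(1) [of 0] in_region(3) [of 1] in_region(4)
    by (intro crossings_eq_1 path pX) (auto simp: pathstart_def pathfinish_def p)
  ultimately have total: "(\<Sum>i<4. crossings (f \<circ> ([p0, p1, p2, p3] ! i))) = 1"
    by (simp add: eval_nat_numeral)
  have crossings_simplex: "crossings (f \<circ> simplex_of_path g \<circ> edge_point) = crossings (f \<circ> g)" for g
    by (simp add: crossings_def log_defect_def pathstart_def pathfinish_def simplex_of_path_edge_point
        cong: winding_number_cong)
  have "\<not> trivial_group (cohomology_group (int 1) X (additive_group :: 'k monoid))"
  proof (rule nontrivial_cohomology_if_cocycle_nonzero_on_cycle)
    show "(\<Sum>k\<le>Suc 1. (-1) ^ k * (of_int (crossings (f \<circ> singular_face (Suc 1) k \<sigma> \<circ> edge_point)) :: 'k)) = 0"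
      if "singular_simplex (Suc 1) X \<sigma>" for \<sigma>
      using that f nz by (rule crossings_cocycle)
    show "singular_simplex 1 X (simplex_of_path ([p0, p1, p2, p3] ! i))" if "i < 4" for i
      using that pX by (intro singular_simplex_simplex_of_path) (auto simp: less_Suc_eq eval_nat_numeral)
    show "chain_boundary 1 (\<Sum>i<4. frag_of (simplex_of_path ([p0, p1, p2, p3] ! i))) = 0"
      by (simp add: eval_nat_numeral chain_boundary_add chain_boundary_simplex_of_path [simplified] p)
    show "(\<Sum>i<4. of_int (crossings (f \<circ> simplex_of_path ([p0, p1, p2, p3] ! i) \<circ> edge_point)) :: 'k) \<noteq> 0"
      using total by (simp add: crossings_simplex flip: of_int_sum)
  qed
  then show ?thesis by simp
qed

section \<open>Products of matrices, unitary matrices and the torus\<close>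

definition matprod :: "'n::finite cmat list \<Rightarrow> 'n cmat"
  where "matprod As = foldr (**) As (mat 1)"

lemma matprod_simps [simp]:
  "matprod [] = mat 1" "matprod (A # As) = A ** matprod As"
  by (simp_all add: matprod_def)

lemma matprod_append [simp]: "matprod (As @ Bs) = matprod As ** matprod Bs"
  by (induction As) (simp_all add: matrix_mul_assoc)

lemma foldr_eq_matprod: "foldr (\<lambda>r B. c r ** B) rs (mat 1) = matprod (map c rs)"
  by (induction rs) simp_all

lemma cyclic_shift_eq_rotate: "cyclic_shift xs k = rotate (nat (k mod int (length xs))) xs"
proof (cases "xs = []")
  case False
  have "nat ((int r + k) mod int (length xs)) = (nat (k mod int (length xs)) + r) mod length xs" for r
    using False by (simp add: nat_eq_iff zmod_int mod_simps add.commute)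
  with False show ?thesis
    by (auto simp: cyclic_shift_def nth_rotate intro!: nth_equalityI)
qed (simp add: cyclic_shift_def)

lemma length_cyclic_shift [simp]: "length (cyclic_shift xs k) = length xs"
  by (simp add: cyclic_shift_def)

lemma nth_cyclic_shift:
  "r < length xs \<Longrightarrow> cyclic_shift xs k ! r = xs ! nat ((int r + k) mod int (length xs))"
  by (simp add: cyclic_shift_def)

lemma cyclic_shift_uminus:
  "cyclic_shift (cyclic_shift xs k) (- k) = xs"
proof (cases "xs = []")
  case False
  have "(k mod int (length xs) + - k mod int (length xs)) mod int (length xs) = 0"
    by (simp add: mod_simps)
  then have "(nat (k mod int (length xs)) + nat (- k mod int (length xs))) mod length xs = 0"
    using False by (simp flip: nat_add_distrib nat_mod_distrib add: nat_mod_as_int)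
  then show ?thesis
    by (simp add: cyclic_shift_eq_rotate rotate_rotate add.commute rotate_id)
qed (simp add: cyclic_shift_def)

text \<open>Rotating a factorization of the identity is a conjugation.\<close>
lemma matprod_cyclic_shift:
  assumes "matprod As = mat 1"
  shows "matprod (cyclic_shift As k) = mat 1"
proof -
  have "matprod (rotate m As) = mat 1" for m
  proof -
    let ?j = "m mod length As"
    have "matprod (take ?j As) ** matprod (drop ?j As) = mat 1"
      using assms by (metis append_take_drop_id matprod_append)
    then show ?thesis
      by (simp add: rotate_drop_take matrix_left_right_inverse)
  qed
  then show ?thesis
    by (simp add: cyclic_shift_eq_rotate)
qed

definition unitary :: "'n::finite cmat \<Rightarrow> bool"
  where "unitary A \<longleftrightarrow> A ** conj_transpose A = mat 1"

lemma conj_transpose_mult: "conj_transpose (A ** B) = conj_transpose B ** conj_transpose A"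
  by (simp add: conj_transpose_def matrix_matrix_mult_def vec_eq_iff mult.commute)

lemma conj_transpose_mat_1 [simp]: "conj_transpose (mat 1) = mat 1"
  by (simp add: conj_transpose_def mat_def vec_eq_iff)

lemma unitary_mat_1 [simp]: "unitary (mat 1)"
  by (simp add: unitary_def)

lemma unitary_mult: "unitary A \<Longrightarrow> unitary B \<Longrightarrow> unitary (A ** B)"
  unfolding unitary_def conj_transpose_mult
  by (metis matrix_mul_assoc matrix_mul_rid)

lemma unitary_left: "unitary A \<Longrightarrow> conj_transpose A ** A = mat 1"
  by (simp add: unitary_def matrix_left_right_inverse)

lemma unitary_conj_transpose: "unitary A \<Longrightarrow> unitary (conj_transpose A)"
proof -
  have "conj_transpose (conj_transpose A) = A"
    by (simp add: conj_transpose_def vec_eq_iff)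
  then show "unitary A \<Longrightarrow> unitary (conj_transpose A)"
    by (simp add: unitary_def unitary_left [unfolded unitary_def])
qed

lemma unitary_rows:
  assumes "unitary A"
  shows "(\<Sum>l\<in>UNIV. A $ i $ l * cnj (A $ j $ l)) = (if i = j then 1 else 0)"
proof -
  have "(A ** conj_transpose A) $ i $ j = mat 1 $ i $ j"
    using assms by (simp add: unitary_def)
  then show ?thesis
    by (simp add: matrix_matrix_mult_def conj_transpose_def mat_def)
qed

lemma matrix_inv_unitary:
  assumes "unitary A"
  shows "matrix_inv A = conj_transpose A"
proof -
  have "A ** matrix_inv A = mat 1"
    using someI [of "\<lambda>B. A ** B = mat 1 \<and> B ** A = mat 1" "conj_transpose A"] assms unitary_left [OF assms]
    unfolding matrix_inv_def unitary_def by blast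
  then have "conj_transpose A = conj_transpose A ** (A ** matrix_inv A)"
    by simp
  then show ?thesis
    by (simp add: matrix_mul_assoc unitary_left assms)
qed

lemma torus_offdiag: "K \<in> torus \<Longrightarrow> i \<noteq> j \<Longrightarrow> K $ i $ j = 0"
  by (simp add: torus_def)

lemma torus_unitary: "K \<in> torus \<Longrightarrow> unitary K"
  by (simp add: torus_def SU_def unitary_def)

lemma diag_mult:
  assumes "\<And>i j. i \<noteq> j \<Longrightarrow> K $ i $ j = 0"
  shows "(K ** A) $ i $ j = K $ i $ i * A $ i $ j" "(A ** K) $ i $ j = A $ i $ j * K $ j $ j"
proof -
  have "(\<Sum>l\<in>UNIV. K $ i $ l * A $ l $ j) = (\<Sum>l\<in>{i}. K $ i $ l * A $ l $ j)"
    by (intro sum.mono_neutral_right) (simp_all add: assms)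
  then show "(K ** A) $ i $ j = K $ i $ i * A $ i $ j"
    by (simp add: matrix_matrix_mult_def)
  have "(\<Sum>l\<in>UNIV. A $ i $ l * K $ l $ j) = (\<Sum>l\<in>{j}. A $ i $ l * K $ l $ j)"
    by (intro sum.mono_neutral_right) (simp_all add: assms)
  then show "(A ** K) $ i $ j = A $ i $ j * K $ j $ j"
    by (simp add: matrix_matrix_mult_def)
qed

lemma torus_norm:
  assumes "K \<in> torus"
  shows "norm (K $ i $ i) = 1"
proof -
  have "K $ i $ i * cnj (K $ i $ i) = 1"
    using unitary_rows [OF torus_unitary [OF assms], of i i] diag_mult(1) [of K "conj_transpose K" i i]
      torus_offdiag [OF assms] by (simp add: matrix_matrix_mult_def conj_transpose_def)
  then show ?thesis
    by (metis complex_mod_cnj norm_mult norm_one power2_eq_square real_sqrt_abs real_sqrt_one abs_norm_cancel)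
qed

lemma mat_1_torus [simp]: "(mat 1 :: 'n::finite cmat) \<in> torus"
proof -
  have "(mat 1 :: 'n cmat) $ i $ j = 0" if "i \<noteq> j" for i j
    using that by (simp add: mat_def)
  then show ?thesis
    by (simp add: torus_def SU_def)
qed

lemma torus_mult:
  assumes "K \<in> torus" "L \<in> torus"
  shows "K ** L \<in> torus"
proof -
  have "unitary (K ** L)"
    using assms by (simp add: unitary_mult torus_unitary)
  moreover have "det (K ** L) = 1"
    using assms by (simp add: det_mul torus_def SU_def)
  ultimately show ?thesis
    using assms by (auto simp: torus_def SU_def unitary_def diag_mult(1) [OF torus_offdiag])
qed

lemma torus_inv:
  assumes "K \<in> torus"
  shows "conj_transpose K \<in> torus"
proof -
  have "det (K ** conj_transpose K) = 1"
    using torus_unitary [OF assms] by (simp add: unitary_def)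
  then have "det (conj_transpose K) = 1"
    using assms by (simp add: det_mul torus_def SU_def)
  then show ?thesis
    using unitary_conj_transpose [OF torus_unitary [OF assms]] assms
    by (simp add: torus_def SU_def unitary_def) (simp add: conj_transpose_def)
qed

lemma torus_matrix_inv: "K \<in> torus \<Longrightarrow> matrix_inv K \<in> torus"
  by (simp add: matrix_inv_unitary torus_unitary torus_inv)

lemma torus_matrix_inv_mult: "K \<in> torus \<Longrightarrow> K ** matrix_inv K = mat 1"
    "K \<in> torus \<Longrightarrow> matrix_inv K ** K = mat 1"
  using torus_unitary [of K] by (simp_all add: matrix_inv_unitary unitary_left) (simp add: unitary_def)

lemma norm_torus_mult:
  "K \<in> torus \<Longrightarrow> norm ((K ** A) $ i $ j) = norm (A $ i $ j)"
  "K \<in> torus \<Longrightarrow> norm ((A ** K) $ i $ j) = norm (A $ i $ j)"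
  by (simp_all add: diag_mult [OF torus_offdiag] norm_mult torus_norm)

lemma torus_coset_mult:
  assumes "K \<in> torus"
  shows "torus_coset (A ** K) = torus_coset A"
proof -
  have "A ** L = A ** K ** (matrix_inv K ** L)" for L
    using torus_matrix_inv_mult(1) [OF assms] by (metis matrix_mul_assoc matrix_mul_rid)
  then show ?thesis
    using assms unfolding torus_coset_def
    by (force simp: torus_mult torus_matrix_inv simp flip: matrix_mul_assoc)
qed

text \<open>All that the obstruction below uses of a factor: it is unitary, and its only off-diagonal entries
are the two exchanging \<open>x\<close> and \<open>y\<close>. The diagonal may carry arbitrary phases, which makes the property
stable under multiplication with the torus.\<close>
definition two_block :: "'n::finite \<Rightarrow> 'n \<Rightarrow> 'n cmat \<Rightarrow> bool"
  where "two_block x y A \<longleftrightarrow> unitary A \<and> (\<forall>i j. i \<noteq> j \<longrightarrow> {i, j} \<noteq> {x, y} \<longrightarrow> A $ i $ j = 0)"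

lemma embed2_mult:
  assumes "p \<noteq> q"
  shows "embed2 p q A ** embed2 p q B = embed2 p q (A ** B)"
proof -
  have "(\<Sum>l\<in>UNIV. embed2 p q A $ i $ l * embed2 p q B $ l $ j) = embed2 p q (A ** B) $ i $ j" for i j
  proof (cases "i \<in> {p, q}")
    case True
    then have "(\<Sum>l\<in>UNIV. embed2 p q A $ i $ l * embed2 p q B $ l $ j) =
        (\<Sum>l\<in>{p, q}. embed2 p q A $ i $ l * embed2 p q B $ l $ j)"
      by (intro sum.mono_neutral_right) (auto simp: embed2_def)
    with True assms show ?thesis
      by (auto simp: embed2_def matrix_matrix_mult_def sum_2)
  next
    case False
    then have "(\<Sum>l\<in>UNIV. embed2 p q A $ i $ l * embed2 p q B $ l $ j) =
        (\<Sum>l\<in>{i}. embed2 p q A $ i $ l * embed2 p q B $ l $ j)"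
      by (intro sum.mono_neutral_right) (auto simp: embed2_def)
    with False show ?thesis
      by (auto simp: embed2_def)
  qed
  then show ?thesis
    by (simp add: vec_eq_iff matrix_matrix_mult_def [of "embed2 p q A"])
qed

lemma embed2_mat_1: "p \<noteq> q \<Longrightarrow> embed2 p q (mat 1) = mat 1"
  by (auto simp: embed2_def mat_def vec_eq_iff)

lemma conj_transpose_embed2: "conj_transpose (embed2 p q A) = embed2 p q (conj_transpose A)"
  by (auto simp: embed2_def conj_transpose_def vec_eq_iff)

lemma transpose_eq_imp_pair_eq:
  assumes "Transposition.transpose x y = Transposition.transpose p q" "p \<noteq> q"
  shows "{x, y} = {p, q}"
proof -
  have "Transposition.transpose x y p \<noteq> p" "Transposition.transpose x y q \<noteq> q"
    using assms by simp_all
  with \<open>p \<noteq> q\<close> show ?thesis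
    by (metis doubleton_eq_iff transpose_apply_other insert_commute)
qed

lemma C_refl_two_block:
  assumes "c \<in> C_refl (Transposition.transpose x y)"
  shows "two_block x y c"
proof -
  obtain p q A K where c: "c = embed2 p q A ** K" "p < q" "A \<in> SU" "K \<in> torus"
    and t: "Transposition.transpose x y = Transposition.transpose p q"
    using assms unfolding C_refl_def by blast
  have "unitary (embed2 p q A)"
    using c by (simp add: unitary_def conj_transpose_embed2 embed2_mult embed2_mat_1 SU_def)
  moreover have "{x, y} = {p, q}"
    using transpose_eq_imp_pair_eq [OF t] c by simp
  ultimately show ?thesis
    using c unfolding two_block_def
    by (auto simp: unitary_mult torus_unitary diag_mult(2) [OF torus_offdiag] embed2_def)
qed

lemma two_block_torus_mult: "K \<in> torus \<Longrightarrow> two_block x y A \<Longrightarrow> two_block x y (K ** A)"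
  by (auto simp: two_block_def unitary_mult torus_unitary diag_mult(1) [OF torus_offdiag])

text \<open>Rotation in the plane of the basis vectors \<open>p\<close> and \<open>q\<close>, from \<open>p\<close> towards \<open>q\<close>.\<close>
definition rot :: "'n \<Rightarrow> 'n \<Rightarrow> real \<Rightarrow> 'n::finite cmat"
  where "rot p q \<theta> = (\<chi> i j.
    if i = p \<and> j = p \<or> i = q \<and> j = q then of_real (cos \<theta>)
    else if i = q \<and> j = p then of_real (sin \<theta>)
    else if i = p \<and> j = q then - of_real (sin \<theta>)
    else if i = j then 1 else 0)"

lemma rot_swap: "p \<noteq> q \<Longrightarrow> rot q p \<theta> = rot p q (- \<theta>)"
  by (auto simp: rot_def vec_eq_iff)

text \<open>The subgroup attached to a reflection is described through the pair in increasing order; in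
decreasing order the rotation is the one by the opposite angle.\<close>
lemma rot_in_C_refl:
  fixes p q :: "'n::{finite,linorder}"
  assumes "p \<noteq> q"
  shows "rot p q \<theta> \<in> C_refl (Transposition.transpose p q)"
proof -
  have *: "rot p q \<theta> \<in> C_refl (Transposition.transpose p q)" if "p < q" for p q :: 'n and \<theta>
  proof -
    define R :: "2 cmat" where "R = vector [vector [of_real (cos \<theta>), - of_real (sin \<theta>)],
        vector [of_real (sin \<theta>), of_real (cos \<theta>)]]"
    have cs: "complex_of_real (cos \<theta>) * complex_of_real (cos \<theta>) +
        complex_of_real (sin \<theta>) * complex_of_real (sin \<theta>) = 1"
      by (metis of_real_1 of_real_add of_real_mult power2_eq_square sin_cos_squared_add2)
    have "R \<in> SU"
      using cs by (simp add: SU_def R_def det_2 vec_eq_iff forall_2 matrix_matrix_mult_def sum_2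
          conj_transpose_def mat_def add.commute)
    moreover have "rot p q \<theta> = embed2 p q R ** mat 1"
      using that by (auto simp: rot_def embed2_def R_def vec_eq_iff)
    ultimately show ?thesis
      using that unfolding C_refl_def
      by (intro CollectI exI [of _ p] exI [of _ q] exI [of _ R] exI [of _ "mat 1"]) simp
  qed
  show ?thesis
  proof (cases "p < q")
    case False
    with assms * [of q p "- \<theta>"] rot_swap [OF assms, of "- \<theta>"] show ?thesis
      by (simp add: transpose_commute)
  qed (rule *)
qed

section \<open>Functions on the fibre and paths in the fibre\<close>

lemma torus_orbit_restrict: "torus_orbit m (restrict c {..<m}) = torus_orbit m c"
  by (auto simp: torus_orbit_def torus_act_def fun_eq_iff image_iff)

lemma torus_orbit_nonempty: "torus_orbit m c \<noteq> {}"
proof -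
  have "(\<lambda>r\<in>{..<m}. mat 1) \<in> (\<Pi>\<^sub>E r\<in>{..<m}. torus)"
    by simp
  then show ?thesis
    unfolding torus_orbit_def by blast
qed

text \<open>The torus element at position \<open>r\<close> cancels against its inverse at position \<open>r + 1\<close>; only the last one
survives.\<close>
lemma matprod_torus_act:
  assumes k: "k \<in> (\<Pi>\<^sub>E r\<in>{..<m}. torus)" and "l \<le> m"
  shows "matprod (map (torus_act m c k) [0..<l]) =
    matprod (map c [0..<l]) ** (if l = 0 then mat 1 else k (l - 1))"
  using \<open>l \<le> m\<close>
proof (induction l)
  case (Suc l)
  have "k (l - 1) ** (matrix_inv (k (l - 1)) ** c l ** k l) = c l ** k l" if "l \<noteq> 0"
  proof -
    have "k (l - 1) \<in> torus"
      by (rule PiE_mem [OF k]) (use Suc.prems in simp)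
    then show ?thesis
      by (simp add: matrix_mul_assoc torus_matrix_inv_mult)
  qed
  moreover have "torus_act m c k l = (if l = 0 then c l ** k l else matrix_inv (k (l - 1)) ** c l ** k l)"
    using Suc.prems by (simp add: torus_act_def)
  ultimately have "(if l = 0 then mat 1 else k (l - 1)) ** torus_act m c k l = c l ** k l"
    by auto
  with Suc show ?case
    by (simp flip: matrix_mul_assoc)
qed simp

lemma BS_proj_torus_orbit:
  "BS_proj m (torus_orbit m c) = torus_coset (matprod (map c [0..<m]))"
proof -
  have "torus_coset (matprod (map (torus_act m c k) [0..<m])) = torus_coset (matprod (map c [0..<m]))"
    if "k \<in> (\<Pi>\<^sub>E r\<in>{..<m}. torus)" for k
  proof (cases "m = 0")
    case False
    then have "k (m - 1) \<in> torus"
      by (intro PiE_mem [OF that]) simp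
    with False show ?thesis
      by (simp add: matprod_torus_act [OF that order_refl] torus_coset_mult)
  qed simp
  then have "(\<lambda>c. torus_coset (matprod (map c [0..<m]))) ` torus_orbit m c \<subseteq>
      {torus_coset (matprod (map c [0..<m]))}"
    unfolding torus_orbit_def by blast
  then have "(\<lambda>c. torus_coset (matprod (map c [0..<m]))) ` torus_orbit m c =
      {torus_coset (matprod (map c [0..<m]))}"
    using torus_orbit_nonempty [of m c] by blast
  then show ?thesis
    by (simp add: BS_proj_def foldr_eq_matprod)
qed

lemma topspace_BS_one:
  "topspace (BS_one ts) = {torus_orbit (length ts) c | c.
    c \<in> topspace (BS_product ts) \<and> matprod (map c [0..<length ts]) \<in> torus}"
proof -
  have "torus_coset A = torus_coset (mat 1) \<longleftrightarrow> A \<in> torus" for A :: "'a cmat"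
  proof
    assume "torus_coset A = torus_coset (mat 1)"
    moreover have "A ** mat 1 \<in> torus_coset A"
      unfolding torus_coset_def by (intro imageI mat_1_torus)
    moreover have "torus_coset (mat 1 :: 'a cmat) = torus"
      by (simp add: torus_coset_def)
    ultimately show "A \<in> torus"
      by simp
  next
    assume "A \<in> torus"
    then show "torus_coset A = torus_coset (mat 1)"
      using torus_coset_mult [of A "mat 1"] by (simp only: matrix_mul_lid)
  qed
  then have proj: "BS_proj (length ts) (torus_orbit (length ts) c) = torus_coset (mat 1) \<longleftrightarrow>
      matprod (map c [0..<length ts]) \<in> torus" for c :: "nat \<Rightarrow> 'a cmat"
    by (simp only: BS_proj_torus_orbit)
  have "topspace (BS_one ts) = {x \<in> torus_orbit (length ts) ` topspace (BS_product ts).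
      BS_proj (length ts) x = torus_coset (mat 1)}"
    unfolding BS_one_def BS_fibre_def BS_def by auto
  also have "\<dots> = {torus_orbit (length ts) c | c. c \<in> topspace (BS_product ts) \<and>
      BS_proj (length ts) (torus_orbit (length ts) c) = torus_coset (mat 1)}"
    unfolding Setcompr_eq_image image_def Bex_def by (rule Collect_cong) blast
  finally show ?thesis
    by (simp only: proj)
qed

lemma continuous_map_BS_one:
  fixes h :: "(nat \<Rightarrow> 'n::{finite,linorder} cmat) \<Rightarrow> 'b::topological_space"
  assumes cont: "continuous_map (BS_product ts) euclidean h"
    and inv: "\<And>c k. k \<in> (\<Pi>\<^sub>E r\<in>{..<length ts}. torus) \<Longrightarrow> h (torus_act (length ts) c k) = h c"
  obtains f where "continuous_map (BS_one ts) euclidean f"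
    "\<And>c. f (torus_orbit (length ts) c) = h c"
proof
  let ?f = "\<lambda>x. h (SOME c. c \<in> x)" and ?q = "torus_orbit (length ts)"
  show f: "?f (?q c) = h c" for c
  proof -
    have "(SOME c'. c' \<in> ?q c) \<in> ?q c"
      by (simp add: some_in_eq torus_orbit_nonempty)
    then obtain k where "k \<in> (\<Pi>\<^sub>E r\<in>{..<length ts}. torus)"
        "(SOME c'. c' \<in> ?q c) = torus_act (length ts) c k"
      unfolding torus_orbit_def by blast
    then show ?thesis
      by (simp add: inv)
  qed
  have "continuous_map (BS ts) euclidean ?f"
  proof (rule continuous_compose_quotient_map)
    show "quotient_map (BS_product ts) (BS ts) ?q"
      by (simp add: BS_def quotient_map_quotient_topology)
    show "continuous_map (BS_product ts) euclidean (?f \<circ> ?q)"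
      using cont by (simp add: o_def f)
  qed
  then show "continuous_map (BS_one ts) euclidean ?f"
    by (simp add: BS_one_def BS_fibre_def continuous_map_from_subtopology)
qed

lemma pathin_BS_one:
  assumes cont: "\<And>r. r < length ts \<Longrightarrow> continuous_on {0..1} (\<lambda>t. c t r)"
    and mem: "\<And>r t. r < length ts \<Longrightarrow> t \<in> {0..1} \<Longrightarrow> c t r \<in> C_refl (ts ! r)"
    and one: "\<And>t. t \<in> {0..1} \<Longrightarrow> matprod (map (c t) [0..<length ts]) = mat 1"
  shows "pathin (BS_one ts) (\<lambda>t. torus_orbit (length ts) (c t))"
proof -
  let ?m = "length ts"
  let ?c = "\<lambda>t. restrict (c t) {..<?m}"
  have "continuous_map (top_of_set {0..1}) (BS_product ts) ?c"
    using cont mem unfolding BS_product_def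
    by (auto simp: continuous_map_componentwise continuous_map_in_subtopology)
  moreover have "continuous_map (BS_product ts) (BS ts) (torus_orbit ?m)"
    by (simp add: BS_def quotient_map_quotient_topology quotient_imp_continuous_map)
  ultimately have "continuous_map (top_of_set {0..1}) (BS ts) (torus_orbit ?m \<circ> ?c)"
    by (rule continuous_map_compose)
  then have "continuous_map (top_of_set {0..1}) (BS ts) (\<lambda>t. torus_orbit ?m (c t))"
    by (simp add: o_def torus_orbit_restrict)
  moreover from this have "torus_orbit ?m (c t) \<in> topspace (BS ts)" if "t \<in> {0..1}" for t
    using that unfolding continuous_map_def by auto
  moreover have "BS_proj ?m (torus_orbit ?m (c t)) = torus_coset (mat 1)" if "t \<in> {0..1}" for t
    by (simp add: BS_proj_torus_orbit one [OF that])
  ultimately show ?thesis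
    unfolding pathin_def BS_one_def BS_fibre_def continuous_map_in_subtopology by simp
qed

section \<open>The obstruction\<close>

lemma row_fixed_mult:
  assumes "\<And>l. l \<noteq> i \<Longrightarrow> A $ i $ l = 0"
  shows "(A ** B) $ i $ j = A $ i $ i * B $ i $ j"
proof -
  have "(\<Sum>l\<in>UNIV. A $ i $ l * B $ l $ j) = (\<Sum>l\<in>{i}. A $ i $ l * B $ l $ j)"
    by (intro sum.mono_neutral_right) (simp_all add: assms)
  then show ?thesis
    by (simp add: matrix_matrix_mult_def)
qed

lemma col_fixed_mult:
  assumes "\<And>l. l \<noteq> j \<Longrightarrow> B $ l $ j = 0"
  shows "(A ** B) $ i $ j = A $ i $ j * B $ j $ j"
proof -
  have "(\<Sum>l\<in>UNIV. A $ i $ l * B $ l $ j) = (\<Sum>l\<in>{j}. A $ i $ l * B $ l $ j)"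
    by (intro sum.mono_neutral_right) (simp_all add: assms)
  then show ?thesis
    by (simp add: matrix_matrix_mult_def)
qed

lemma row_pair_mult:
  assumes "p \<noteq> q" "\<And>l. l \<noteq> p \<Longrightarrow> l \<noteq> q \<Longrightarrow> A $ i $ l = 0"
  shows "(A ** B) $ i $ j = A $ i $ p * B $ p $ j + A $ i $ q * B $ q $ j"
proof -
  have "(\<Sum>l\<in>UNIV. A $ i $ l * B $ l $ j) = (\<Sum>l\<in>{p, q}. A $ i $ l * B $ l $ j)"
    by (intro sum.mono_neutral_right) (auto simp: assms)
  with \<open>p \<noteq> q\<close> show ?thesis
    by (simp add: matrix_matrix_mult_def)
qed

lemma matprod_row_fixed:
  assumes "\<And>A l. A \<in> set As \<Longrightarrow> l \<noteq> i \<Longrightarrow> A $ i $ l = 0" and "j \<noteq> i"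
  shows "matprod As $ i $ j = 0"
  using assms
proof (induction As)
  case (Cons A As)
  then show ?case
    by (simp add: row_fixed_mult)
qed (simp add: mat_def)

lemma matprod_col_fixed:
  assumes "\<And>A l. A \<in> set As \<Longrightarrow> l \<noteq> j \<Longrightarrow> A $ l $ j = 0" and "i \<noteq> j"
  shows "matprod As $ i $ j = 0"
  using assms
proof (induction As rule: rev_induct)
  case (snoc A As)
  then show ?case
    by (simp add: col_fixed_mult)
qed (simp add: mat_def)

lemma unitary_matprod: "(\<And>A. A \<in> set As \<Longrightarrow> unitary A) \<Longrightarrow> unitary (matprod As)"
  by (induction As) (simp_all add: unitary_mult)

lemma two_block_zero:
  assumes "two_block x y A" "i \<noteq> x" "i \<noteq> y" "l \<noteq> i"
  shows "A $ i $ l = 0" "A $ l $ i = 0"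
  using assms by (auto simp: two_block_def doubleton_eq_iff)

lemma unitary_row_pair:
  assumes "unitary A" "p \<noteq> q" "\<And>l. l \<noteq> p \<Longrightarrow> l \<noteq> q \<Longrightarrow> A $ i $ l = 0"
  shows "(norm (A $ i $ p))\<^sup>2 + (norm (A $ i $ q))\<^sup>2 = 1"
proof -
  have "(\<Sum>l\<in>UNIV. A $ i $ l * cnj (A $ i $ l)) = (\<Sum>l\<in>{p, q}. A $ i $ l * cnj (A $ i $ l))"
    by (intro sum.mono_neutral_right) (auto simp: assms)
  with unitary_rows [OF \<open>unitary A\<close>, of i i] \<open>p \<noteq> q\<close>
  have "complex_of_real ((norm (A $ i $ p))\<^sup>2 + (norm (A $ i $ q))\<^sup>2) = 1"
    by (simp add: complex_norm_square [symmetric] flip: of_real_power)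
  then show ?thesis
    by (simp only: of_real_eq_1_iff)
qed

lemma unitary_row_single:
  assumes "unitary A" "\<And>l. l \<noteq> p \<Longrightarrow> A $ i $ l = 0"
  shows "A $ i $ p \<noteq> 0"
proof
  assume "A $ i $ p = 0"
  then have "A $ i $ l = 0" for l
    using assms(2) by (cases "l = p") auto
  then show False
    using unitary_rows [OF \<open>unitary A\<close>, of i i] by simp
qed

text \<open>The vertices are numbered from 0, so the star edges are \<open>{v 0, v j}\<close> with \<open>1 \<le> j < n\<close>, the chain
edges are \<open>{v j, v (j + 1)}\<close> with \<open>j + 1 < n\<close>, and \<open>{v (n - 1), v 0}\<close> is the closing edge.\<close>
locale vertex_order =
  fixes ns :: "'n::{finite,linorder} list"
  assumes distinct_ns: "distinct ns" and four: "4 \<le> length ns"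
begin

abbreviation n :: nat where "n \<equiv> length ns"
abbreviation v :: "nat \<Rightarrow> 'n" where "v j \<equiv> ns ! j"

lemma v_eq_iff: "i < n \<Longrightarrow> j < n \<Longrightarrow> v i = v j \<longleftrightarrow> i = j"
  by (simp add: nth_eq_iff_index_eq distinct_ns)

text \<open>Let \<open>N\<close> be the product of the star factors without the first one, and \<open>Y\<close> the product of the chain
factors. Rotating the factorization of the identity gives \<open>z c N = Y\<^sup>*\<close>. In a product of
chain factors nothing lies more than one place below the diagonal (it is an upper Hessenberg matrix), so
in its adjoint nothing lies more than one place above the diagonal. Comparing the first two rows of
both sides, with the block entries of \<open>c\<close> and \<open>z\<close> nonzero, forces so many zeros in \<open>N\<close> that its rows \<open>v 0\<close>, \<open>v 1\<close> and \<open>v (n - 1)\<close> lie in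
the span of two coordinate vectors, which contradicts the orthogonality of the rows. At least four
vertices are needed for \<open>v 2\<close> and \<open>v (n - 1)\<close> to be different.\<close>
lemma not_both_half:
  assumes c: "two_block (v 0) (v 1) c"
    and a: "\<And>j. 2 \<le> j \<Longrightarrow> j < n \<Longrightarrow> two_block (v 0) (v j) (a j)"
    and b: "\<And>j. Suc j < n \<Longrightarrow> two_block (v j) (v (Suc j)) (b j)"
    and z: "two_block (v (n - 1)) (v 0) z"
    and one: "c ** matprod (map a [2..<n]) ** matprod (map b [0..<n - 1]) ** z = mat 1"
  shows "\<not> ((norm (c $ v 1 $ v 0))\<^sup>2 = 1 / 2 \<and> (norm (z $ v 0 $ v (n - 1)))\<^sup>2 = 1 / 2)"
proof
  assume half: "(norm (c $ v 1 $ v 0))\<^sup>2 = 1 / 2 \<and> (norm (z $ v 0 $ v (n - 1)))\<^sup>2 = 1 / 2"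
  define N where "N = matprod (map a [2..<n])"
  define Y where "Y = matprod (map b [0..<n - 1])"
  define L where "L = z ** (c ** N)"
  have "ns \<noteq> []"
    using four by auto
  note n4 = four this
  have ne: "v 0 \<noteq> v 1" "v 0 \<noteq> v 2" "v 1 \<noteq> v 2" "v 0 \<noteq> v (n - 1)" "v 1 \<noteq> v (n - 1)" "v 2 \<noteq> v (n - 1)"
    using n4 by (simp_all add: v_eq_iff)
  have u: "unitary c" "unitary z" "unitary N" "unitary Y"
    using c z a b by (auto simp: two_block_def N_def Y_def intro!: unitary_matprod)
  \<comment> \<open>No factor of \<open>N\<close> involves the vertex \<open>v 1\<close>, and only the last one involves \<open>v (n - 1)\<close>.\<close>
  have N1: "N $ v 1 $ l = 0" if "l \<noteq> v 1" for l
    unfolding N_def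
  proof (rule matprod_row_fixed [OF _ that])
    fix A l assume "A \<in> set (map a [2..<n])" "l \<noteq> v 1"
    then obtain j where "A = a j" "2 \<le> j" "j < n" by auto
    with a [of j] \<open>l \<noteq> v 1\<close> n4 show "A $ v 1 $ l = 0"
      by (intro two_block_zero(1) [of "v 0" "v j"]) (simp_all add: v_eq_iff)
  qed
  have Nlast: "N $ v (n - 1) $ l = 0" if "l \<noteq> v 0" "l \<noteq> v (n - 1)" for l
  proof -
    have "[2..<n] = [2..<n - 1] @ [n - 1]"
      using four by (cases n) simp_all
    then have N: "N = matprod (map a [2..<n - 1]) ** a (n - 1)"
      by (simp add: N_def)
    have "matprod (map a [2..<n - 1]) $ v (n - 1) $ l = 0" if "l \<noteq> v (n - 1)" for l
    proof (rule matprod_row_fixed [OF _ that])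
      fix A l assume "A \<in> set (map a [2..<n - 1])" "l \<noteq> v (n - 1)"
      then obtain j where "A = a j" "2 \<le> j" "j < n - 1" by auto
      with a [of j] \<open>l \<noteq> v (n - 1)\<close> n4 show "A $ v (n - 1) $ l = 0"
        by (intro two_block_zero(1) [of "v 0" "v j"]) (simp_all add: v_eq_iff)
    qed
    then have "N $ v (n - 1) $ l = matprod (map a [2..<n - 1]) $ v (n - 1) $ v (n - 1) * a (n - 1) $ v (n - 1) $ l"
      unfolding N by (intro row_fixed_mult)
    also have "a (n - 1) $ v (n - 1) $ l = 0"
      using that a [of "n - 1"] n4 by (intro two_block_zero(2) [of "v 0" "v (n - 1)"]) simp_all
    finally show ?thesis by simp
  qed
  have L_eq: "L = conj_transpose Y"
  proof -
    have "(c ** N ** Y) ** z = mat 1"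
      using one by (simp add: N_def Y_def)
    then have "z ** (c ** N ** Y) = mat 1"
      by (simp add: matrix_left_right_inverse)
    then have "L ** Y = mat 1"
      by (simp add: L_def matrix_mul_assoc)
    then have "L ** (Y ** conj_transpose Y) = conj_transpose Y"
      by (metis matrix_mul_assoc matrix_mul_lid)
    then show ?thesis
      using u(4) by (simp add: unitary_def)
  qed
  have Y: "Y = b 0 ** b 1 ** matprod (map b [2..<n - 1])"
    using n4 unfolding Y_def by (simp add: upt_conv_Cons numeral_2_eq_2 matrix_mul_assoc)
  \<comment> \<open>The chain factors from the third one on only rescale \<open>v 0\<close> and \<open>v 1\<close>, so the zeros in the first two columns
    of \<open>Y\<close> only depend on the first two factors.\<close>
  have tail: "matprod (map b [2..<n - 1]) $ l $ v j = 0" if "j < 2" "l \<noteq> v j" for l j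
  proof (rule matprod_col_fixed [OF _ that(2)])
    fix A l assume "A \<in> set (map b [2..<n - 1])" "l \<noteq> v j"
    then obtain i where "A = b i" "2 \<le> i" "i < n - 1" by auto
    with b [of i] \<open>l \<noteq> v j\<close> \<open>j < 2\<close> n4 show "A $ l $ v j = 0"
      by (intro two_block_zero(2) [of "v i" "v (Suc i)"]) (simp_all add: v_eq_iff)
  qed
  have b0: "b 0 $ i $ l = 0" if "i \<noteq> v 0" "i \<noteq> v 1" "l \<noteq> i" for i l
    using that b [of 0] n4 by (intro two_block_zero(1) [of "v 0" "v 1"]) simp_all
  have b1: "two_block (v 1) (v 2) (b 1)"
    using b [of 1] n4 by (simp add: numeral_2_eq_2)
  have L0: "L $ v 0 $ i = 0" if "i \<noteq> v 0" "i \<noteq> v 1" for i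
  proof -
    have "b 1 $ l $ v 0 = 0" if "l \<noteq> v 0" for l
      using that ne by (intro two_block_zero(2) [OF b1]) simp_all
    then have "Y $ i $ v 0 = b 0 $ i $ v 0 * b 1 $ v 0 $ v 0 * matprod (map b [2..<n - 1]) $ v 0 $ v 0"
      unfolding Y using tail [of 0] by (simp add: col_fixed_mult)
    with b0 [OF that, of "v 0"] that have "Y $ i $ v 0 = 0" by simp
    then show ?thesis
      by (simp add: L_eq conj_transpose_def)
  qed
  have L1: "L $ v 1 $ i = 0" if "i \<noteq> v 0" "i \<noteq> v 1" "i \<noteq> v 2" for i
  proof -
    have "Y $ i $ v 1 = b 0 $ i $ i * b 1 $ i $ v 1 * matprod (map b [2..<n - 1]) $ v 1 $ v 1"
      unfolding Y using tail [of 1] b0 [OF that(1,2)] by (simp add: col_fixed_mult row_fixed_mult)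
    moreover have "b 1 $ i $ v 1 = 0"
      using that ne by (intro two_block_zero(1) [OF b1]) simp_all
    ultimately have "Y $ i $ v 1 = 0" by simp
    then show ?thesis
      by (simp add: L_eq conj_transpose_def)
  qed
  have c_out: "c $ i $ l = 0" "c $ l $ i = 0" if "i \<noteq> v 0" "i \<noteq> v 1" "l \<noteq> i" for i l
    using two_block_zero [OF c that] .
  have z_out: "z $ i $ l = 0" "z $ l $ i = 0" if "i \<noteq> v (n - 1)" "i \<noteq> v 0" "l \<noteq> i" for i l
    using two_block_zero [OF z that] .
  have c_row: "(c ** N) $ v i $ l = c $ v i $ v 0 * N $ v 0 $ l + c $ v i $ v 1 * N $ v 1 $ l" if "i < 2" for i l
    using that ne by (intro row_pair_mult c_out(2)) (auto simp: less_2_cases_iff)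
  have c_last: "(c ** N) $ v (n - 1) $ l = c $ v (n - 1) $ v (n - 1) * N $ v (n - 1) $ l" for l
    using ne by (intro row_fixed_mult c_out(1)) auto
  have z_row: "L $ v 0 $ l = z $ v 0 $ v 0 * (c ** N) $ v 0 $ l + z $ v 0 $ v (n - 1) * (c ** N) $ v (n - 1) $ l" for l
    unfolding L_def using ne by (intro row_pair_mult z_out(2)) auto
  have z1_zero: "z $ v 1 $ l = 0" if "l \<noteq> v 1" for l
    using ne that by (intro z_out(1)) auto
  then have z_one: "L $ v 1 $ l = z $ v 1 $ v 1 * (c ** N) $ v 1 $ l" for l
    unfolding L_def by (rule row_fixed_mult)
  have nz: "c $ v 1 $ v 0 \<noteq> 0" "z $ v 0 $ v (n - 1) \<noteq> 0"
    using half by auto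
  have nz': "z $ v 1 $ v 1 \<noteq> 0" "c $ v (n - 1) $ v (n - 1) \<noteq> 0"
    using ne by (intro unitary_row_single u z1_zero c_out(1); simp)+
  have "(norm (z $ v 0 $ v (n - 1)))\<^sup>2 + (norm (z $ v 0 $ v 0))\<^sup>2 = 1"
    using ne by (intro unitary_row_pair u z_out(2)) auto
  then have z00: "z $ v 0 $ v 0 \<noteq> 0"
    using half by auto
  have "(norm (conj_transpose c $ v 0 $ v 1))\<^sup>2 + (norm (conj_transpose c $ v 0 $ v 0))\<^sup>2 = 1"
    using ne by (intro unitary_row_pair unitary_conj_transpose u) (auto simp: conj_transpose_def c_out)
  then have c00: "c $ v 0 $ v 0 \<noteq> 0"
    using half by (auto simp: conj_transpose_def)
  \<comment> \<open>The zeros of the rows \<open>v 1\<close> and \<open>v 0\<close> of \<open>L = Y\<^sup>*\<close> move to \<open>N\<close>: those of row \<open>v 1\<close> because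
    \<open>c $ v 1 $ v 0 \<noteq> 0\<close>, those of row \<open>v 0\<close> at \<open>v 2\<close> and at
    \<open>v (n - 1)\<close> because the remaining terms have nonzero coefficients.\<close>
  have N0: "N $ v 0 $ l = 0" if "l \<noteq> v 0" "l \<noteq> v 1" "l \<noteq> v 2" for l
    using L1 [OF that] z_one [of l] c_row [of 1 l] N1 [of l] that nz nz' by simp
  have N02: "N $ v 0 $ v 2 = 0"
    using L0 [of "v 2"] z_row [of "v 2"] c_row [of 0 "v 2"] c_last [of "v 2"] Nlast [of "v 2"] N1 [of "v 2"]
      z00 c00 ne by simp
  have "N $ v (n - 1) $ v (n - 1) = 0"
    using L0 [of "v (n - 1)"] z_row [of "v (n - 1)"] c_row [of 0 "v (n - 1)"] c_last [of "v (n - 1)"]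
      N1 [of "v (n - 1)"] N0 [of "v (n - 1)"] ne nz nz' by simp
  then have Nlast': "N $ v (n - 1) $ l = 0" if "l \<noteq> v 0" for l
    using Nlast that by (cases "l = v (n - 1)") auto
  \<comment> \<open>Row \<open>v 0\<close> is now supported in \<open>v 0\<close> and \<open>v 1\<close>, but orthogonal to the rows \<open>v (n - 1)\<close> and \<open>v 1\<close>,
    which are nonzero multiples of the corresponding coordinate vectors.\<close>
  have single: "(\<Sum>l\<in>UNIV. N $ i $ l * cnj (N $ v 0 $ l)) = N $ i $ p * cnj (N $ v 0 $ p)"
    if "\<And>l. l \<noteq> p \<Longrightarrow> N $ i $ l = 0" for i p
  proof -
    have "(\<Sum>l\<in>UNIV. N $ i $ l * cnj (N $ v 0 $ l)) = (\<Sum>l\<in>{p}. N $ i $ l * cnj (N $ v 0 $ l))"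
      by (intro sum.mono_neutral_right) (simp_all add: that)
    then show ?thesis by simp
  qed
  have "N $ v 0 $ v 1 = 0"
    using unitary_rows [OF u(3), of "v 1" "v 0"] single [of "v 1" "v 1", OF N1]
      unitary_row_single [OF u(3) N1] ne by simp
  moreover have "N $ v 0 $ v 0 = 0"
    using unitary_rows [OF u(3), of "v (n - 1)" "v 0"] single [of "v 0" "v (n - 1)", OF Nlast']
      unitary_row_single [OF u(3) Nlast'] ne by simp
  ultimately have "N $ v 0 $ l = 0" if "l \<noteq> v 0" for l
    using N0 N02 by (cases "l = v 1"; cases "l = v 2") (use that in auto)
  then have "N $ v 0 $ v 0 \<noteq> 0"
    by (rule unitary_row_single [OF u(3)])
  with \<open>N $ v 0 $ v 0 = 0\<close> show False by simp
qed

end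

section \<open>Products of rotations equal to one\<close>

lemma rot_vec:
  assumes "p \<noteq> q"
  shows "rot p q \<theta> *v x = (\<chi> i. if i = p then of_real (cos \<theta>) * x $ p - of_real (sin \<theta>) * x $ q
    else if i = q then of_real (sin \<theta>) * x $ p + of_real (cos \<theta>) * x $ q else x $ i)"
proof -
  have "(\<Sum>l\<in>UNIV. rot p q \<theta> $ i $ l * x $ l) = (if i = p then of_real (cos \<theta>) * x $ p - of_real (sin \<theta>) * x $ q
    else if i = q then of_real (sin \<theta>) * x $ p + of_real (cos \<theta>) * x $ q else x $ i)" for i
  proof (cases "i = p \<or> i = q")
    case True
    then have "(\<Sum>l\<in>UNIV. rot p q \<theta> $ i $ l * x $ l) = (\<Sum>l\<in>{p, q}. rot p q \<theta> $ i $ l * x $ l)"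
      by (intro sum.mono_neutral_right) (auto simp: rot_def)
    also have "\<dots> = rot p q \<theta> $ i $ p * x $ p + rot p q \<theta> $ i $ q * x $ q"
      using assms by simp
    finally show ?thesis
      using True assms by (elim disjE) (simp_all add: rot_def)
  next
    case False
    then have "(\<Sum>l\<in>UNIV. rot p q \<theta> $ i $ l * x $ l) = (\<Sum>l\<in>{i}. rot p q \<theta> $ i $ l * x $ l)"
      by (intro sum.mono_neutral_right) (simp_all add: rot_def)
    with False show ?thesis
      by (simp add: rot_def)
  qed
  then show ?thesis
    by (simp add: matrix_vector_mult_def)
qed

lemma rot_0 [simp]: "rot p q 0 = mat 1"
proof -
  have "rot p q 0 $ i $ j = mat 1 $ i $ j" for i j
    unfolding rot_def mat_def vec_lambda_beta cos_zero sin_zero of_real_1 of_real_0 minus_zero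
    by (cases "i = j"; cases "i = p"; cases "i = q"; simp)
  then show ?thesis
    by (simp add: vec_eq_iff)
qed

lemma rot_add:
  assumes "p \<noteq> q"
  shows "rot p q \<alpha> ** rot p q \<beta> = rot p q (\<alpha> + \<beta>)"
proof -
  have "rot p q \<alpha> *v (rot p q \<beta> *v x) = rot p q (\<alpha> + \<beta>) *v x" for x
    using assms by (simp add: rot_vec vec_eq_iff cos_add sin_add algebra_simps)
  then show ?thesis
    by (simp add: matrix_eq matrix_vector_mul_assoc)
qed

lemma rot_commute:
  assumes "p \<noteq> q" "r \<noteq> s" "p \<noteq> r" "p \<noteq> s" "q \<noteq> r" "q \<noteq> s"
  shows "rot p q \<alpha> ** rot r s \<beta> = rot r s \<beta> ** rot p q \<alpha>"
proof -
  have "rot p q \<alpha> *v (rot r s \<beta> *v x) = rot r s \<beta> *v (rot p q \<alpha> *v x)" for x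
    using assms assms [THEN not_sym] by (simp add: rot_vec vec_eq_iff)
  then show ?thesis
    by (simp add: matrix_eq matrix_vector_mul_assoc)
qed

text \<open>A quarter turn carries one basis vector of a rotation plane to another basis vector, hence conjugates
rotations in the old plane to rotations in the new one.\<close>
lemma quarter_rot_conj:
  assumes "p \<noteq> q" "p \<noteq> r" "q \<noteq> r"
  shows "rot p q (pi / 2) ** rot p r \<theta> = rot q r \<theta> ** rot p q (pi / 2)"
    and "rot p q \<theta> ** rot q r (- pi / 2) = rot q r (- pi / 2) ** rot p r \<theta>"
    and "rot p r (pi / 2) ** rot q r \<theta> = rot p q \<theta> ** rot p r (pi / 2)"
proof -
  have "rot p q (pi / 2) *v (rot p r \<theta> *v x) = rot q r \<theta> *v (rot p q (pi / 2) *v x)"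
    and "rot p q \<theta> *v (rot q r (- pi / 2) *v x) = rot q r (- pi / 2) *v (rot p r \<theta> *v x)"
    and "rot p r (pi / 2) *v (rot q r \<theta> *v x) = rot p q \<theta> *v (rot p r (pi / 2) *v x)" for x
    using assms assms [THEN not_sym] by (simp_all add: rot_vec vec_eq_iff)
  then show "rot p q (pi / 2) ** rot p r \<theta> = rot q r \<theta> ** rot p q (pi / 2)"
    and "rot p q \<theta> ** rot q r (- pi / 2) = rot q r (- pi / 2) ** rot p r \<theta>"
    and "rot p r (pi / 2) ** rot q r \<theta> = rot p q \<theta> ** rot p r (pi / 2)"
    by (simp_all add: matrix_eq matrix_vector_mul_assoc)
qed

lemma matprod_commute:
  assumes "\<And>A. A \<in> set As \<Longrightarrow> A ** B = B ** A"
  shows "matprod As ** B = B ** matprod As"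
  using assms
proof (induction As)
  case (Cons A As)
  have IH: "matprod As ** B = B ** matprod As" and AB: "A ** B = B ** A"
    using Cons by simp_all
  have "matprod (A # As) ** B = A ** (matprod As ** B)"
    by (simp add: matrix_mul_assoc)
  also have "\<dots> = A ** B ** matprod As"
    by (simp only: IH matrix_mul_assoc)
  also have "\<dots> = B ** matprod (A # As)"
    by (simp only: AB matprod_simps matrix_mul_assoc)
  finally show ?case .
qed simp

lemma matprod_eq_one: "(\<And>A. A \<in> set As \<Longrightarrow> A = mat 1) \<Longrightarrow> matprod As = mat 1"
  by (induction As) simp_all

context vertex_order
begin

text \<open>
  A point of the loop is given by a rotation angle for every edge: \<open>s j\<close> for the star edge at \<open>j\<close>,
  \<open>p j\<close> for the chain edge from \<open>j\<close> to \<open>j + 1\<close>, and \<open>z\<close> for the closing edge.\<close>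
definition star_rots :: "(nat \<Rightarrow> real) \<Rightarrow> nat \<Rightarrow> nat \<Rightarrow> 'n cmat list"
  where "star_rots s a b = map (\<lambda>j. rot (v 0) (v j) (s j)) [a..<b]"

definition chain_rots :: "(nat \<Rightarrow> real) \<Rightarrow> nat \<Rightarrow> nat \<Rightarrow> 'n cmat list"
  where "chain_rots p a b = map (\<lambda>j. rot (v j) (v (Suc j)) (p j)) [a..<b]"

definition rots :: "(nat \<Rightarrow> real) \<Rightarrow> (nat \<Rightarrow> real) \<Rightarrow> real \<Rightarrow> 'n cmat list"
  where "rots s p z = star_rots s 1 n @ chain_rots p 0 (n - 1) @ [rot (v (n - 1)) (v 0) z]"

lemma star_rots_split: "a \<le> b \<Longrightarrow> b \<le> c \<Longrightarrow> star_rots s a c = star_rots s a b @ star_rots s b c"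
  using upt_add_eq_append [of a b "c - b"] by (simp add: star_rots_def flip: map_append)

lemma chain_rots_split: "a \<le> b \<Longrightarrow> b \<le> c \<Longrightarrow> chain_rots p a c = chain_rots p a b @ chain_rots p b c"
  using upt_add_eq_append [of a b "c - b"] by (simp add: chain_rots_def flip: map_append)

lemma star_rots_single: "star_rots s a (Suc a) = [rot (v 0) (v a) (s a)]"
  by (simp add: star_rots_def)

lemma chain_rots_single: "chain_rots p a (Suc a) = [rot (v a) (v (Suc a)) (p a)]"
  by (simp add: chain_rots_def)

lemma star_rots_cong: "(\<And>j. a \<le> j \<Longrightarrow> j < b \<Longrightarrow> s j = s' j) \<Longrightarrow> star_rots s a b = star_rots s' a b"
  by (simp add: star_rots_def)

lemma chain_rots_cong: "(\<And>j. a \<le> j \<Longrightarrow> j < b \<Longrightarrow> p j = p' j) \<Longrightarrow> chain_rots p a b = chain_rots p' a b"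
  by (simp add: chain_rots_def)

lemma star_rots_0: "(\<And>j. a \<le> j \<Longrightarrow> j < b \<Longrightarrow> s j = 0) \<Longrightarrow> matprod (star_rots s a b) = mat 1"
  unfolding star_rots_def by (rule matprod_eq_one) auto

lemma chain_rots_0: "(\<And>j. a \<le> j \<Longrightarrow> j < b \<Longrightarrow> p j = 0) \<Longrightarrow> matprod (chain_rots p a b) = mat 1"
  unfolding chain_rots_def by (rule matprod_eq_one) auto

lemma ns_nonempty [simp]: "ns \<noteq> []"
  using four by auto

lemma v_neq: "i < n \<Longrightarrow> j < n \<Longrightarrow> i \<noteq> j \<Longrightarrow> v i \<noteq> v j"
  by (simp add: v_eq_iff)

lemma star_rots_commute:
  assumes "1 \<le> a" "b \<le> n" "i < n" "j < n" "i \<noteq> j" "i \<noteq> 0" "j \<noteq> 0" "i \<notin> {a..<b}" "j \<notin> {a..<b}"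
  shows "matprod (star_rots s a b) ** rot (v i) (v j) \<theta> = rot (v i) (v j) \<theta> ** matprod (star_rots s a b)"
proof (rule matprod_commute)
  fix A assume "A \<in> set (star_rots s a b)"
  then obtain l where l: "A = rot (v 0) (v l) (s l)" "a \<le> l" "l < b"
    by (auto simp: star_rots_def)
  have "0 < n" using assms by linarith
  have "i \<noteq> l" "j \<noteq> l"
    using assms l by auto
  then show "A ** rot (v i) (v j) \<theta> = rot (v i) (v j) \<theta> ** A"
    unfolding l(1) using assms l(2,3) \<open>0 < n\<close>
    by (intro rot_commute) (simp_all add: v_eq_iff)
qed

abbreviation "quarter \<equiv> (\<lambda>j::nat. pi / 2)"
abbreviation "neg_quarter \<equiv> (\<lambda>j::nat. - pi / 2)"

text \<open>The star quarter turns at \<open>1, \<dots>, b\<close> carry \<open>v 0\<close> to \<open>v b\<close> and fix \<open>v b'\<close>, and the chain of negative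
quarter turns up to \<open>b\<close> is their inverse.\<close>
lemma star_chain_conj:
  assumes "b < b'" "b' < n"
  shows "matprod (star_rots quarter 1 (Suc b)) ** rot (v 0) (v b') \<theta> ** matprod (chain_rots neg_quarter 0 b)
    = rot (v b) (v b') \<theta>"
  using assms
proof (induction b arbitrary: b' \<theta>)
  case 0
  then show ?case
    by (simp add: star_rots_def chain_rots_def)
next
  case (Suc b)
  let ?S = "matprod (star_rots quarter 1 (Suc b))" and ?C = "matprod (chain_rots neg_quarter 0 b)"
  let ?r = "\<lambda>i j. rot (v i) (v j)"
  have S: "matprod (star_rots quarter 1 (Suc (Suc b))) = ?S ** ?r 0 (Suc b) (pi / 2)"
    using star_rots_split [of 1 "Suc b" "Suc (Suc b)"] by (simp add: star_rots_single)
  have C: "matprod (chain_rots neg_quarter 0 (Suc b)) = ?C ** ?r b (Suc b) (- pi / 2)"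
    by (simp add: chain_rots_split [of 0 b "Suc b"] chain_rots_single)
  have conj: "?r 0 (Suc b) (pi / 2) ** ?r 0 b' \<theta> = ?r (Suc b) b' \<theta> ** ?r 0 (Suc b) (pi / 2)"
    using Suc.prems by (intro quarter_rot_conj v_neq) auto
  have comm: "?S ** ?r (Suc b) b' \<theta> = ?r (Suc b) b' \<theta> ** ?S"
    using Suc.prems by (intro star_rots_commute) auto
  have IH: "?S ** ?r 0 (Suc b) (pi / 2) ** ?C = ?r b (Suc b) (pi / 2)"
    using Suc by simp
  have "?S ** ?r 0 (Suc b) (pi / 2) ** ?r 0 b' \<theta> ** (?C ** ?r b (Suc b) (- pi / 2))
      = ?S ** (?r 0 (Suc b) (pi / 2) ** ?r 0 b' \<theta>) ** ?C ** ?r b (Suc b) (- pi / 2)"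
    by (simp only: matrix_mul_assoc)
  also have "\<dots> = (?S ** ?r (Suc b) b' \<theta>) ** ?r 0 (Suc b) (pi / 2) ** ?C ** ?r b (Suc b) (- pi / 2)"
    unfolding conj by (simp only: matrix_mul_assoc)
  also have "\<dots> = ?r (Suc b) b' \<theta> ** (?S ** ?r 0 (Suc b) (pi / 2) ** ?C) ** ?r b (Suc b) (- pi / 2)"
    unfolding comm by (simp only: matrix_mul_assoc)
  also have "\<dots> = ?r (Suc b) b' \<theta> ** (?r b (Suc b) (pi / 2) ** ?r b (Suc b) (- pi / 2))"
    unfolding IH by (simp only: matrix_mul_assoc)
  also have "\<dots> = ?r (Suc b) b' \<theta>"
    using Suc.prems by (subst rot_add) (simp_all add: v_eq_iff)
  finally show ?case
    unfolding S C .
qed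

lemma matprod_rots:
  "matprod (rots s p z) = matprod (star_rots s 1 n) ** matprod (chain_rots p 0 (n - 1)) ** rot (v (n - 1)) (v 0) z"
  by (simp add: rots_def matrix_mul_assoc)

text \<open>
  The first kind of segment: the star quarter turns before \<open>b\<close> are switched on and undone by the chain,
  and the star angle at \<open>b\<close> grows together with the chain angle of the edge that ends in \<open>b\<close>.\<close>
definition star_up :: "nat \<Rightarrow> real \<Rightarrow> nat \<Rightarrow> real"
  where "star_up b \<theta> j = (if j < b then pi / 2 else if j = b then \<theta> else 0)"

definition chain_up :: "nat \<Rightarrow> real \<Rightarrow> nat \<Rightarrow> real"
  where "chain_up b \<theta> j = (if Suc j < b then - pi / 2 else if Suc j = b then - \<theta> else 0)"

lemma matprod_up:
  assumes "1 \<le> b" "b < n"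
  shows "matprod (rots (star_up b \<theta>) (chain_up b \<theta>) 0) = mat 1"
proof -
  obtain a where b: "b = Suc a"
    using assms by (cases b) auto
  have "star_rots (star_up b \<theta>) 1 n = star_rots (star_up b \<theta>) 1 b @ star_rots (star_up b \<theta>) b (Suc b) @ star_rots (star_up b \<theta>) (Suc b) n"
    using assms star_rots_split [of 1 b n] star_rots_split [of b "Suc b" n] by simp
  then have S: "matprod (star_rots (star_up b \<theta>) 1 n) = matprod (star_rots quarter 1 b) ** rot (v 0) (v b) \<theta>"
    using star_rots_cong [of 1 b "star_up b \<theta>" quarter] star_rots_0 [of "Suc b" n "star_up b \<theta>"]
    by (simp add: star_up_def star_rots_single)
  have "chain_rots (chain_up b \<theta>) 0 (n - 1) = chain_rots (chain_up b \<theta>) 0 a @ chain_rots (chain_up b \<theta>) a b @ chain_rots (chain_up b \<theta>) b (n - 1)"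
    using assms chain_rots_split [of 0 a "n - 1"] chain_rots_split [of a b "n - 1"] by (simp add: b)
  then have C: "matprod (chain_rots (chain_up b \<theta>) 0 (n - 1)) = matprod (chain_rots neg_quarter 0 a) ** rot (v a) (v b) (- \<theta>)"
    using chain_rots_cong [of 0 a "chain_up b \<theta>" neg_quarter] chain_rots_0 [of b "n - 1" "chain_up b \<theta>"]
    by (simp add: chain_up_def b chain_rots_single)
  have "matprod (rots (star_up b \<theta>) (chain_up b \<theta>) 0) =
      (matprod (star_rots quarter 1 b) ** rot (v 0) (v b) \<theta> ** matprod (chain_rots neg_quarter 0 a)) ** rot (v a) (v b) (- \<theta>)"
    unfolding matprod_rots S C by (simp add: matrix_mul_assoc)
  also have "\<dots> = rot (v a) (v b) \<theta> ** rot (v a) (v b) (- \<theta>)"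
    using star_chain_conj [of a b \<theta>] assms by (simp add: b)
  also have "\<dots> = mat 1"
    using assms by (subst rot_add) (simp_all add: b v_eq_iff)
  finally show ?thesis .
qed

text \<open>The chain of negative quarter turns up to \<open>b\<close> carries \<open>v b\<close> to \<open>v 0\<close> and \<open>v 0\<close> to \<open>- v 1\<close>.\<close>
lemma rot_chain_commute:
  assumes "1 \<le> b" "b < n"
  shows "rot (v 0) (v 1) \<theta> ** matprod (chain_rots neg_quarter 0 b)
    = matprod (chain_rots neg_quarter 0 b) ** rot (v 0) (v b) \<theta>"
  using assms
proof (induction b rule: dec_induct)
  case base
  then show ?case
    by (simp add: chain_rots_def rot_add add.commute v_eq_iff)
next
  case (step b)
  let ?C = "matprod (chain_rots neg_quarter 0 b)"
  let ?r = "\<lambda>i j. rot (v i) (v j)"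
  have C: "matprod (chain_rots neg_quarter 0 (Suc b)) = ?C ** ?r b (Suc b) (- pi / 2)"
    by (simp add: chain_rots_split [of 0 b "Suc b"] chain_rots_single)
  have conj: "?r 0 b \<theta> ** ?r b (Suc b) (- pi / 2) = ?r b (Suc b) (- pi / 2) ** ?r 0 (Suc b) \<theta>"
    using step by (intro quarter_rot_conj v_neq) auto
  have "?r 0 1 \<theta> ** ?C = ?C ** ?r 0 b \<theta>"
    using step by simp
  then have "?r 0 1 \<theta> ** (?C ** ?r b (Suc b) (- pi / 2)) = ?C ** (?r 0 b \<theta> ** ?r b (Suc b) (- pi / 2))"
    by (simp only: matrix_mul_assoc)
  also have "\<dots> = ?C ** ?r b (Suc b) (- pi / 2) ** ?r 0 (Suc b) \<theta>"
    unfolding conj by (simp only: matrix_mul_assoc)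
  finally show ?case
    unfolding C .
qed

text \<open>
  The second kind of segment: all star quarter turns are switched on, and the closing angle grows
  while the first chain quarter turn is switched off.\<close>
definition chain_turn :: "real \<Rightarrow> nat \<Rightarrow> real"
  where "chain_turn \<theta> j = (if j = 0 then \<theta> - pi / 2 else - pi / 2)"

lemma rot_swap_cancel: "p \<noteq> q \<Longrightarrow> rot p q \<theta> ** rot q p \<theta> = mat 1"
  by (simp add: rot_swap [of p q] rot_add)

lemma matprod_turn: "matprod (rots quarter (chain_turn \<theta>) \<theta>) = mat 1"
proof -
  let ?S = "matprod (star_rots quarter 1 n)" and ?C = "matprod (chain_rots neg_quarter 0 (n - 1))"
  have n0: "0 < n" "1 < n" "n - 1 < n" "0 \<noteq> n - 1" "n = Suc (n - 1)" "n - 1 = Suc (n - 2)"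
    using four by linarith+
  have C: "matprod (chain_rots (chain_turn \<theta>) 0 (n - 1)) = rot (v 0) (v 1) \<theta> ** ?C"
  proof -
    have "chain_rots (chain_turn \<theta>) 0 (n - 1) = chain_rots (chain_turn \<theta>) 0 1 @ chain_rots (chain_turn \<theta>) 1 (n - 1)"
      and "chain_rots neg_quarter 0 (n - 1) = chain_rots neg_quarter 0 1 @ chain_rots neg_quarter 1 (n - 1)"
      using four by (intro chain_rots_split; simp)+
    moreover have "chain_rots (chain_turn \<theta>) 1 (n - 1) = chain_rots neg_quarter 1 (n - 1)"
      by (intro chain_rots_cong) (simp add: chain_turn_def)
    moreover have "rot (v 0) (v 1) (\<theta> - pi / 2) = rot (v 0) (v 1) \<theta> ** rot (v 0) (v 1) (- pi / 2)"
      using n0(1,2) by (subst rot_add) (simp_all add: v_eq_iff)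
    ultimately show ?thesis
      using chain_rots_single [of "chain_turn \<theta>" 0] chain_rots_single [of neg_quarter 0]
      by (simp add: chain_turn_def matrix_mul_assoc)
  qed
  have "?S ** ?C = mat 1"
  proof -
    have "star_rots quarter 1 n = star_rots quarter 1 (n - 1) @ star_rots quarter (n - 1) n"
      using four by (intro star_rots_split) auto
    then have S: "?S = matprod (star_rots quarter 1 (Suc (n - 2))) ** rot (v 0) (v (n - 1)) (pi / 2)"
      using star_rots_single [of quarter "n - 1"] n0(5,6) by simp
    have "chain_rots neg_quarter 0 (n - 1) = chain_rots neg_quarter 0 (n - 2) @ chain_rots neg_quarter (n - 2) (n - 1)"
      by (intro chain_rots_split) auto
    then have "?C = matprod (chain_rots neg_quarter 0 (n - 2)) ** rot (v (n - 2)) (v (n - 1)) (- pi / 2)"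
      using chain_rots_single [of neg_quarter "n - 2"] n0(6) by simp
    then have "?S ** ?C = (matprod (star_rots quarter 1 (Suc (n - 2))) ** rot (v 0) (v (n - 1)) (pi / 2)
        ** matprod (chain_rots neg_quarter 0 (n - 2))) ** rot (v (n - 2)) (v (n - 1)) (- pi / 2)"
      unfolding S by (simp only: matrix_mul_assoc)
    also have "\<dots> = mat 1"
      using four by (subst star_chain_conj) (auto simp: rot_add v_neq)
    finally show ?thesis .
  qed
  moreover have comm: "rot (v 0) (v 1) \<theta> ** ?C = ?C ** rot (v 0) (v (n - 1)) \<theta>"
    using four by (intro rot_chain_commute) auto
  ultimately have "matprod (rots quarter (chain_turn \<theta>) \<theta>) = rot (v 0) (v (n - 1)) \<theta> ** rot (v (n - 1)) (v 0) \<theta>"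
    unfolding matprod_rots C comm by (simp add: matrix_mul_assoc)
  then show ?thesis
    using v_neq [OF n0(1,3,4)] by (simp add: rot_swap_cancel)
qed

text \<open>The quarter turn at \<open>c + 1\<close> carries \<open>v (c + 1)\<close> to \<open>- v 0\<close>, and the later ones involve neither \<open>v c\<close> nor
\<open>v (c + 1)\<close>.\<close>
lemma star_rots_conj:
  assumes "1 \<le> c" "Suc c < n"
  shows "matprod (star_rots quarter (Suc c) n) ** rot (v c) (v (Suc c)) \<theta> =
    rot (v 0) (v c) \<theta> ** matprod (star_rots quarter (Suc c) n)"
proof -
  let ?S = "matprod (star_rots quarter (Suc (Suc c)) n)"
  let ?r = "\<lambda>i j. rot (v i) (v j)"
  have S: "matprod (star_rots quarter (Suc c) n) = ?r 0 (Suc c) (pi / 2) ** ?S"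
    using star_rots_split [of "Suc c" "Suc (Suc c)" n] assms by (simp add: star_rots_single)
  have comm: "?S ** ?r c (Suc c) \<theta> = ?r c (Suc c) \<theta> ** ?S"
    using assms by (intro star_rots_commute) auto
  have conj: "?r 0 (Suc c) (pi / 2) ** ?r c (Suc c) \<theta> = ?r 0 c \<theta> ** ?r 0 (Suc c) (pi / 2)"
    using assms by (intro quarter_rot_conj v_neq) auto
  show ?thesis
  proof -
    have "?r 0 (Suc c) (pi / 2) ** ?S ** ?r c (Suc c) \<theta> = ?r 0 (Suc c) (pi / 2) ** (?S ** ?r c (Suc c) \<theta>)"
      by (simp only: matrix_mul_assoc)
    also have "\<dots> = ?r 0 (Suc c) (pi / 2) ** ?r c (Suc c) \<theta> ** ?S"
      unfolding comm by (simp only: matrix_mul_assoc)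
    also have "\<dots> = ?r 0 c \<theta> ** (?r 0 (Suc c) (pi / 2) ** ?S)"
      unfolding conj by (simp only: matrix_mul_assoc)
    finally show ?thesis
      unfolding S .
  qed
qed

text \<open>By the preceding conjugation the first star and chain factors cancel, until only the star edge
\<open>{v 0, v (n - 1)}\<close> and the closing edge are left; these rotate in opposite directions of the same plane.\<close>
lemma star_chain_close:
  assumes "1 \<le> c" "c \<le> n - 1"
  shows "matprod (star_rots quarter c n) ** matprod (chain_rots neg_quarter c (n - 1))
    ** rot (v (n - 1)) (v 0) (pi / 2) = mat 1"
  using assms(2,1)
proof (induction c rule: inc_induct)
  case base
  have "n = Suc (n - 1)" "0 < n" "n - 1 < n" "0 \<noteq> n - 1"
    using four by linarith+
  then show ?case
    using star_rots_single [of quarter "n - 1"] v_neq [of 0 "n - 1"] by (simp add: chain_rots_def rot_swap_cancel)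
next
  case (step c)
  let ?S = "matprod (star_rots quarter (Suc c) n)" and ?C = "matprod (chain_rots neg_quarter (Suc c) (n - 1))"
  let ?z = "rot (v (n - 1)) (v 0) (pi / 2)"
  have lt: "Suc c < n" "c < n" "0 < n"
    using step by auto
  have S: "matprod (star_rots quarter c n) = rot (v 0) (v c) (pi / 2) ** ?S"
    using star_rots_split [of c "Suc c" n] lt by (simp add: star_rots_single)
  have C: "matprod (chain_rots neg_quarter c (n - 1)) = rot (v c) (v (Suc c)) (- pi / 2) ** ?C"
    using chain_rots_split [of c "Suc c" "n - 1"] lt step by (simp add: chain_rots_single)
  have "matprod (star_rots quarter c n) ** matprod (chain_rots neg_quarter c (n - 1)) ** ?z
      = rot (v 0) (v c) (pi / 2) ** (?S ** rot (v c) (v (Suc c)) (- pi / 2)) ** ?C ** ?z"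
    unfolding S C by (simp only: matrix_mul_assoc)
  also have "\<dots> = rot (v 0) (v c) (pi / 2) ** rot (v 0) (v c) (- pi / 2) ** (?S ** ?C ** ?z)"
    unfolding star_rots_conj [OF \<open>1 \<le> c\<close> lt(1)] by (simp only: matrix_mul_assoc)
  also have "\<dots> = mat 1"
    using step lt by (subst rot_add) (simp_all add: v_eq_iff)
  finally show ?case .
qed

text \<open>
  The third kind of segment: the closing quarter turn is switched on together with those of the star after
  \<open>a\<close> and of the chain after \<open>a\<close>, while the quarter turns of both at \<open>a\<close> are switched off.\<close>
definition star_down :: "nat \<Rightarrow> real \<Rightarrow> nat \<Rightarrow> real"
  where "star_down a \<theta> j = (if j < a then 0 else if j = a then \<theta> else pi / 2)"

definition chain_down :: "nat \<Rightarrow> real \<Rightarrow> nat \<Rightarrow> real"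
  where "chain_down a \<theta> j = (if j < a then 0 else if j = a then - \<theta> else - pi / 2)"

lemma matprod_down:
  assumes "1 \<le> a" "Suc a < n"
  shows "matprod (rots (star_down a \<theta>) (chain_down a \<theta>) (pi / 2)) = mat 1"
proof -
  let ?S = "matprod (star_rots quarter (Suc a) n)" and ?C = "matprod (chain_rots neg_quarter (Suc a) (n - 1))"
  let ?z = "rot (v (n - 1)) (v 0) (pi / 2)"
  have "star_rots (star_down a \<theta>) 1 n = star_rots (star_down a \<theta>) 1 a @ star_rots (star_down a \<theta>) a (Suc a) @ star_rots (star_down a \<theta>) (Suc a) n"
    using assms star_rots_split [of 1 a n] star_rots_split [of a "Suc a" n] by simp
  then have S: "matprod (star_rots (star_down a \<theta>) 1 n) = rot (v 0) (v a) \<theta> ** ?S"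
    using star_rots_cong [of "Suc a" n "star_down a \<theta>" quarter] star_rots_0 [of 1 a "star_down a \<theta>"]
    by (simp add: star_down_def star_rots_single)
  have "chain_rots (chain_down a \<theta>) 0 (n - 1) = chain_rots (chain_down a \<theta>) 0 a @ chain_rots (chain_down a \<theta>) a (Suc a) @ chain_rots (chain_down a \<theta>) (Suc a) (n - 1)"
    using assms chain_rots_split [of 0 a "n - 1"] chain_rots_split [of a "Suc a" "n - 1"] by simp
  then have C: "matprod (chain_rots (chain_down a \<theta>) 0 (n - 1)) = rot (v a) (v (Suc a)) (- \<theta>) ** ?C"
    using chain_rots_cong [of "Suc a" "n - 1" "chain_down a \<theta>" neg_quarter] chain_rots_0 [of 0 a "chain_down a \<theta>"]
    by (simp add: chain_down_def chain_rots_single)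
  have "matprod (rots (star_down a \<theta>) (chain_down a \<theta>) (pi / 2)) =
      rot (v 0) (v a) \<theta> ** (?S ** rot (v a) (v (Suc a)) (- \<theta>)) ** ?C ** ?z"
    unfolding matprod_rots S C by (simp only: matrix_mul_assoc)
  also have "\<dots> = rot (v 0) (v a) \<theta> ** rot (v 0) (v a) (- \<theta>) ** (?S ** ?C ** ?z)"
    unfolding star_rots_conj [OF assms] by (simp only: matrix_mul_assoc)
  also have "\<dots> = mat 1"
    using assms star_chain_close [of "Suc a"] by (subst rot_add) (simp_all add: v_eq_iff)
  finally show ?thesis .
qed

text \<open>The last segment switches off the remaining star and closing quarter turns simultaneously.\<close>
lemma matprod_last:
  "matprod (rots (star_down (n - 1) \<theta>) (\<lambda>_. 0) \<theta>) = mat 1"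
proof -
  have n0: "n = Suc (n - 1)" "0 < n" "n - 1 < n" "0 \<noteq> n - 1"
    using four by linarith+
  have "star_rots (star_down (n - 1) \<theta>) 1 n = star_rots (star_down (n - 1) \<theta>) 1 (n - 1) @ star_rots (star_down (n - 1) \<theta>) (n - 1) n"
    using four by (intro star_rots_split) auto
  then have "matprod (star_rots (star_down (n - 1) \<theta>) 1 n) = rot (v 0) (v (n - 1)) \<theta>"
    using star_rots_single [of "star_down (n - 1) \<theta>" "n - 1"] star_rots_0 [of 1 "n - 1" "star_down (n - 1) \<theta>"] n0(1)
    by (simp add: star_down_def)
  then show ?thesis
    using v_neq [OF n0(2-4)] by (simp add: matprod_rots chain_rots_0 rot_swap_cancel)
qed

end

section \<open>A loop around the centre of a square\<close>

lemma nth_cyclic_shift_back: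
  assumes "r < length xs"
  shows "cyclic_shift xs k ! nat ((int r - k) mod int (length xs)) = xs ! r"
proof -
  have "cyclic_shift (cyclic_shift xs k) (- k) ! r = cyclic_shift xs k ! nat ((int r - k) mod int (length xs))"
    using nth_cyclic_shift [of r "cyclic_shift xs k" "- k"] assms by simp
  then show ?thesis
    by (simp add: cyclic_shift_uminus)
qed

context vertex_order
begin

abbreviation m :: nat where "m \<equiv> 2 * n - 1"

lemma length_d_seq: "length (d_seq ns) = m"
  using four by (simp add: d_seq_def)

lemma d_seq_eq:
  "d_seq ns = map (\<lambda>j. Transposition.transpose (v 0) (v j)) [1..<n] @
    map (\<lambda>j. Transposition.transpose (v j) (v (Suc j))) [0..<n - 1] @ [Transposition.transpose (v (n - 1)) (v 0)]"
  by (simp add: d_seq_def)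

lemma d_seq_nth:
  "1 \<le> j \<Longrightarrow> j < n \<Longrightarrow> d_seq ns ! (j - 1) = Transposition.transpose (v 0) (v j)"
  "j < n - 1 \<Longrightarrow> d_seq ns ! (n - 1 + j) = Transposition.transpose (v j) (v (Suc j))"
  "d_seq ns ! (m - 1) = Transposition.transpose (v (n - 1)) (v 0)"
proof -
  show "d_seq ns ! (j - 1) = Transposition.transpose (v 0) (v j)" if "1 \<le> j" "j < n"
  proof -
    have "j - 1 < n - 1"
      using that by linarith
    with that show ?thesis
      by (simp add: d_seq_eq nth_append)
  qed
  show "d_seq ns ! (n - 1 + j) = Transposition.transpose (v j) (v (Suc j))" if "j < n - 1"
  proof -
    have "\<not> n - 1 + j < n - 1" "n - 1 + j - (n - 1) = j"
      by simp_all
    with that show ?thesis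
      unfolding d_seq_eq by (simp add: nth_append del: diff_add_assoc diff_add_assoc2)
  qed
  have "\<not> m - 1 < n - 1"
    using four by linarith
  then show "d_seq ns ! (m - 1) = Transposition.transpose (v (n - 1)) (v 0)"
    by (simp add: d_seq_eq nth_append)
qed

lemma length_rots [simp]: "length (rots s p z) = m"
  using four by (simp add: rots_def star_rots_def chain_rots_def)

lemma rots_nth_ends: "rots s p z ! 0 = rot (v 0) (v 1) (s 1)" "rots s p z ! (m - 1) = rot (v (n - 1)) (v 0) z"
proof -
  have "\<not> m - 1 < n - 1" "0 < n - 1"
    using four by linarith+
  then show "rots s p z ! 0 = rot (v 0) (v 1) (s 1)" "rots s p z ! (m - 1) = rot (v (n - 1)) (v 0) z"
    by (simp_all add: rots_def star_rots_def chain_rots_def nth_append)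
qed

lemma rots_in_C_refl:
  assumes "r < m"
  shows "rots s p z ! r \<in> C_refl (d_seq ns ! r)"
proof -
  have "list_all2 (\<lambda>A t. A \<in> C_refl t) (rots s p z) (d_seq ns)"
    unfolding rots_def d_seq_eq star_rots_def chain_rots_def
    using four
    by (intro list_all2_appendI)
      (auto simp: list_all2_conv_all_nth v_eq_iff intro!: rot_in_C_refl)
  then show ?thesis
    using assms by (simp add: list_all2_conv_all_nth)
qed

end

locale shifted_order = vertex_order ns for ns :: "'n::{finite,linorder} list" +
  fixes k :: int
begin

abbreviation X :: "(nat \<Rightarrow> 'n cmat) set topology"
  where "X \<equiv> BS_one (cyclic_shift (d_seq ns) k)"

text \<open>Where the cyclic shift moves the factor with index \<open>r\<close>.\<close>
definition pos :: "nat \<Rightarrow> nat"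
  where "pos r = nat ((int r - k) mod int m)"

lemma nth_pos: "length xs = m \<Longrightarrow> r < m \<Longrightarrow> cyclic_shift xs k ! pos r = xs ! r"
  using nth_cyclic_shift_back [of r xs k] by (simp only: pos_def)

lemma pos_less: "pos r < m"
  using four by (simp add: pos_def nat_less_iff)

text \<open>
  The squared absolute values of one off-diagonal entry of the first star factor and of the closing
  factor map the fibre to the unit square, which is translated here so that its centre becomes 0.\<close>
definition square :: "(nat \<Rightarrow> 'n cmat) \<Rightarrow> complex"
  where "square c = Complex ((norm (c (pos 0) $ v 1 $ v 0))\<^sup>2 - 1 / 2)
    ((norm (c (pos (m - 1)) $ v 0 $ v (n - 1)))\<^sup>2 - 1 / 2)"

definition rot_point :: "(nat \<Rightarrow> real) \<Rightarrow> (nat \<Rightarrow> real) \<Rightarrow> real \<Rightarrow> (nat \<Rightarrow> 'n cmat) set"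
  where "rot_point s p z = torus_orbit m (\<lambda>r. cyclic_shift (rots s p z) k ! r)"

lemma square_rots:
  "square (\<lambda>r. cyclic_shift (rots s p z) k ! r) = Complex ((sin (s 1))\<^sup>2 - 1 / 2) ((sin z)\<^sup>2 - 1 / 2)"
proof -
  have "0 < m" "m - 1 < m"
    using four by linarith+
  then have "cyclic_shift (rots s p z) k ! pos 0 = rot (v 0) (v 1) (s 1)"
      "cyclic_shift (rots s p z) k ! pos (m - 1) = rot (v (n - 1)) (v 0) z"
    by (simp_all only: nth_pos length_rots rots_nth_ends)
  moreover have "v 0 \<noteq> v 1" "v 0 \<noteq> v (n - 1)"
    using four by (simp_all add: v_eq_iff)
  ultimately show ?thesis
    unfolding square_def by (simp add: rot_def)
qed

lemma square_torus_act:
  assumes "l \<in> (\<Pi>\<^sub>E r\<in>{..<m}. torus)"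
  shows "square (torus_act m c l) = square c"
proof -
  have norm_eq: "norm (torus_act m c l r $ i $ j) = norm (c r $ i $ j)" if "r < m" for r i j
  proof -
    have "l r \<in> torus" "r \<noteq> 0 \<Longrightarrow> l (r - 1) \<in> torus"
      using that by (auto intro!: PiE_mem [OF assms])
    then show ?thesis
      using that by (cases "r = 0") (auto simp: torus_act_def norm_torus_mult torus_matrix_inv)
  qed
  show ?thesis
    unfolding square_def by (simp only: norm_eq [OF pos_less])
qed

lemma continuous_map_square:
  "continuous_map (BS_product (cyclic_shift (d_seq ns) k)) euclidean square"
proof -
  let ?P = "BS_product (cyclic_shift (d_seq ns) k)"
  have entry: "continuous_map ?P euclidean (\<lambda>c. c r $ i $ j)" if "r < m" for r i j
  proof -
    have "continuous_map ?P (top_of_set (C_refl (cyclic_shift (d_seq ns) k ! r))) (\<lambda>c. c r)"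
      unfolding BS_product_def using that by (intro continuous_map_product_projection) (simp add: length_d_seq)
    then have "continuous_map ?P euclidean (\<lambda>c. c r)"
      by (simp add: continuous_map_in_subtopology)
    moreover have "continuous_map euclidean euclidean (\<lambda>A :: 'n cmat. A $ i $ j)"
      by (simp add: continuous_intros)
    ultimately show ?thesis
      using continuous_map_compose [of ?P euclidean "\<lambda>c. c r" euclidean "\<lambda>A. A $ i $ j"] by (simp add: o_def)
  qed
  let ?g = "\<lambda>w. Complex ((norm (fst w))\<^sup>2 - 1 / 2) ((norm (snd w))\<^sup>2 - 1 / 2)"
  have "continuous_map euclidean euclidean ?g"
    by (simp add: Complex_eq continuous_intros)
  moreover have "continuous_map ?P euclidean (\<lambda>c. (c (pos 0) $ v 1 $ v 0, c (pos (m - 1)) $ v 0 $ v (n - 1)))"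
    using continuous_map_pairedI [OF entry entry] pos_less by (simp only: prod_topology_euclidean)
  ultimately have "continuous_map ?P euclidean (?g \<circ> (\<lambda>c. (c (pos 0) $ v 1 $ v 0, c (pos (m - 1)) $ v 0 $ v (n - 1))))"
    by (rule continuous_map_compose [rotated])
  then show ?thesis
    by (simp add: o_def square_def [abs_def])
qed

text \<open>After moving the product, which lies in the torus, into the first factor, the factorization of the
identity may be rotated back to the unshifted order. Neither operation changes the absolute values of
entries.\<close>
lemma square_nonzero:
  assumes c: "c \<in> topspace (BS_product (cyclic_shift (d_seq ns) k))"
    and K: "matprod (map c [0..<m]) \<in> torus"
  shows "square c \<noteq> 0"
proof
  assume zero: "square c = 0"
  let ?K = "matprod (map c [0..<m])"
  define d where "d r = (if r = 0 then matrix_inv ?K ** c 0 else c r)" for r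
  have "0 < m"
    using four by linarith
  then have ms: "[0..<m] = 0 # [1..<m]"
    by (simp add: upt_conv_Cons)
  have d1: "matprod (map d [0..<m]) = mat 1"
  proof -
    have K_eq: "?K = c 0 ** matprod (map c [1..<m])"
      by (simp only: ms list.map matprod_simps)
    have "map d [1..<m] = map c [1..<m]"
      by (simp add: d_def)
    then have "matprod (map d [0..<m]) = d 0 ** matprod (map c [1..<m])"
      by (simp only: ms list.map matprod_simps)
    also have "d 0 = matrix_inv ?K ** c 0"
      by (simp add: d_def)
    also have "\<dots> ** matprod (map c [1..<m]) = matrix_inv ?K ** ?K"
      by (simp only: K_eq [symmetric] flip: matrix_mul_assoc)
    finally have "matprod (map d [0..<m]) = matrix_inv ?K ** ?K" .
    then show ?thesis
      by (simp only: torus_matrix_inv_mult(2) [OF K])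
  qed
  define es where "es = cyclic_shift (map d [0..<m]) (- k)"
  have es1: "matprod es = mat 1"
    unfolding es_def by (rule matprod_cyclic_shift [OF d1])
  have len: "length es = m"
    by (simp add: es_def)
  have es_nth: "es ! r = d (pos r)" if "r < m" for r
    using that pos_less [of r] nth_cyclic_shift [of r "map d [0..<m]" "- k"]
    by (simp add: es_def pos_def)
  have block: "two_block x y (es ! r)" if "r < m" "d_seq ns ! r = Transposition.transpose x y" for r x y
  proof -
    have "c (pos r) \<in> C_refl (cyclic_shift (d_seq ns) k ! pos r)"
      using c pos_less [of r] by (auto simp: BS_product_def length_d_seq)
    also have "cyclic_shift (d_seq ns) k ! pos r = d_seq ns ! r"
      using that(1) by (simp only: nth_pos length_d_seq)
    finally have "two_block x y (c (pos r))"
      using that(2) by (simp add: C_refl_two_block)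
    then show ?thesis
      unfolding es_nth [OF that(1)] d_def
      using torus_matrix_inv [OF K] by (cases "pos r = 0") (simp_all add: two_block_torus_mult)
  qed
  have es_split: "es = es ! 0 # map (\<lambda>j. es ! (j - 1)) [2..<n] @ map (\<lambda>j. es ! (n - 1 + j)) [0..<n - 1] @ [es ! (m - 1)]"
    using four by (intro nth_equalityI) (auto simp: len nth_Cons nth_append intro!: arg_cong [where f = "(!) es"] split: nat.split)
  have "es ! 0 ** matprod (map (\<lambda>j. es ! (j - 1)) [2..<n]) ** matprod (map (\<lambda>j. es ! (n - 1 + j)) [0..<n - 1])
      ** es ! (m - 1) = mat 1"
    using es1 by (subst (asm) es_split) (simp add: matrix_mul_assoc)
  then have "\<not> ((norm (es ! 0 $ v 1 $ v 0))\<^sup>2 = 1 / 2 \<and> (norm (es ! (m - 1) $ v 0 $ v (n - 1)))\<^sup>2 = 1 / 2)"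
  proof (intro not_both_half)
    show "two_block (v 0) (v 1) (es ! 0)"
      using four d_seq_nth(1) [of 1] by (intro block) simp_all
    show "two_block (v 0) (v j) (es ! (j - 1))" if "2 \<le> j" "j < n" for j
      using that d_seq_nth(1) [of j] by (intro block) linarith+
    show "two_block (v j) (v (Suc j)) (es ! (n - 1 + j))" if "Suc j < n" for j
      using that d_seq_nth(2) [of j] by (intro block) linarith+
    show "two_block (v (n - 1)) (v 0) (es ! (m - 1))"
      using four by (intro block d_seq_nth(3)) linarith
  qed
  moreover have "norm (d r $ i $ j) = norm (c r $ i $ j)" for r i j
    using torus_matrix_inv [OF K] by (simp add: d_def norm_torus_mult)
  ultimately show False
    using zero \<open>0 < m\<close> by (simp add: es_nth square_def complex_eq_iff)
qed

lemma continuous_on_const_if: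
  "(P \<Longrightarrow> continuous_on A f) \<Longrightarrow> (\<not> P \<Longrightarrow> continuous_on A g) \<Longrightarrow>
    continuous_on A (\<lambda>x. if P then f x else g x)"
  by (cases P) simp_all

text \<open>A one-parameter family of angles whose rotations multiply to 1 is a path in the fibre. The region
\<open>R\<close> of the square in which it stays is read off from the first star angle and the closing angle.\<close>
lemma rot_point_path:
  fixes s p :: "real \<Rightarrow> nat \<Rightarrow> real" and z :: "real \<Rightarrow> real"
  assumes f: "\<And>c. f (torus_orbit m c) = square c"
    and s: "\<And>j. continuous_on UNIV (\<lambda>\<theta>. s \<theta> j)" and p: "\<And>j. continuous_on UNIV (\<lambda>\<theta>. p \<theta> j)"
    and z: "continuous_on UNIV z"
    and one: "\<And>\<theta>. matprod (rots (s \<theta>) (p \<theta>) (z \<theta>)) = mat 1"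
    and region: "\<And>\<theta>. Complex ((sin (s \<theta> 1))\<^sup>2 - 1 / 2) ((sin (z \<theta>))\<^sup>2 - 1 / 2) \<in> R"
  shows "path_component_of (subtopology X {x. f x \<in> R}) (rot_point (s \<alpha>) (p \<alpha>) (z \<alpha>)) (rot_point (s \<beta>) (p \<beta>) (z \<beta>))"
proof -
  let ?l = "\<lambda>t. (1 - t) * \<alpha> + t * \<beta>"
  let ?c = "\<lambda>t r. cyclic_shift (rots (s (?l t)) (p (?l t)) (z (?l t))) k ! r"
  have cont_rot: "continuous_on {0..1} (\<lambda>t. rot x y (h (?l t)))"
    if "continuous_on UNIV h" for x y :: 'n and h :: "real \<Rightarrow> real"
  proof -
    have "continuous_on {0..1} (\<lambda>t. h (?l t))"
      by (rule continuous_on_compose2 [OF that]) (auto intro!: continuous_intros)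
    then show ?thesis
      unfolding rot_def by (intro continuous_on_vec_lambda continuous_on_const_if continuous_intros)
  qed
  have rots_cont: "continuous_on {0..1} (\<lambda>t. rots (s (?l t)) (p (?l t)) (z (?l t)) ! r)" if "r < m" for r
  proof -
    consider "r < n - 1" | "n - 1 \<le> r" "r < m - 1" | "r = m - 1"
      using \<open>r < m\<close> by linarith
    then show ?thesis
    proof cases
      case 1
      then show ?thesis
        using cont_rot [OF s] by (simp add: rots_def star_rots_def nth_append)
    next
      case 2
      then have "Suc r - n < n - 1"
        by linarith
      with 2 show ?thesis
        using cont_rot [OF p] by (simp add: rots_def star_rots_def chain_rots_def nth_append)
    next
      case 3
      then show ?thesis
        unfolding 3 rots_nth_ends by (intro cont_rot z)
    qed
  qed
  have "pathin X (\<lambda>t. torus_orbit (length (cyclic_shift (d_seq ns) k)) (?c t))"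
  proof (rule pathin_BS_one)
    fix r assume r: "r < length (cyclic_shift (d_seq ns) k)"
    let ?r = "nat ((int r + k) mod int m)"
    have "?r < m"
      using four by (simp add: nat_less_iff)
    have shift: "?c t r = rots (s (?l t)) (p (?l t)) (z (?l t)) ! ?r" for t
      using r by (simp add: nth_cyclic_shift length_d_seq)
    show "continuous_on {0..1} (\<lambda>t. ?c t r)"
      unfolding shift by (rule rots_cont [OF \<open>?r < m\<close>])
    show "?c t r \<in> C_refl (cyclic_shift (d_seq ns) k ! r)" for t
      using rots_in_C_refl [OF \<open>?r < m\<close>] r unfolding shift by (simp add: nth_cyclic_shift length_d_seq)
  next
    fix t :: real
    have "map (?c t) [0..<length (cyclic_shift (d_seq ns) k)] = cyclic_shift (rots (s (?l t)) (p (?l t)) (z (?l t))) k"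
      by (rule nth_equalityI) (simp_all add: length_d_seq)
    then show "matprod (map (?c t) [0..<length (cyclic_shift (d_seq ns) k)]) = mat 1"
      by (simp only: matprod_cyclic_shift one)
  qed
  then have "pathin X (\<lambda>t. rot_point (s (?l t)) (p (?l t)) (z (?l t)))"
    by (simp add: rot_point_def length_d_seq)
  moreover have "f (rot_point (s \<theta>) (p \<theta>) (z \<theta>)) \<in> R" for \<theta>
    unfolding rot_point_def f square_rots by (rule region)
  ultimately have "pathin (subtopology X {x. f x \<in> R}) (\<lambda>t. rot_point (s (?l t)) (p (?l t)) (z (?l t)))"
    unfolding pathin_def continuous_map_in_subtopology by auto
  then show ?thesis
    unfolding path_component_of_def
    by (intro exI [of _ "\<lambda>t. rot_point (s (?l t)) (p (?l t)) (z (?l t))"] conjI) simp_all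
qed

lemma continuous_up: "continuous_on UNIV (\<lambda>\<theta>. star_up b \<theta> j)" "continuous_on UNIV (\<lambda>\<theta>. chain_up b \<theta> j)"
  unfolding star_up_def chain_up_def by (intro continuous_on_const_if continuous_intros)+

lemma continuous_down: "continuous_on UNIV (\<lambda>\<theta>. star_down b \<theta> j)" "continuous_on UNIV (\<lambda>\<theta>. chain_down b \<theta> j)"
  unfolding star_down_def chain_down_def by (intro continuous_on_const_if continuous_intros)+

lemma continuous_turn: "continuous_on UNIV (\<lambda>\<theta>. chain_turn \<theta> j)"
  unfolding chain_turn_def by (intro continuous_on_const_if continuous_intros)+

lemma rot_point_cong:
  assumes "\<And>j. 1 \<le> j \<Longrightarrow> j < n \<Longrightarrow> s j = s' j" "\<And>j. j < n - 1 \<Longrightarrow> p j = p' j"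
  shows "rot_point s p z = rot_point s' p' z"
  using star_rots_cong [of 1 n s s'] chain_rots_cong [of 0 "n - 1" p p'] assms
  by (simp add: rot_point_def rots_def)

text \<open>The loop: the star and chain quarter turns are switched on one after the other, then the closing one,
and then all are switched off in the same order. The square function moves along its four sides: the
first star angle grows, the closing angle grows, the first star angle returns to 0, and the closing
angle returns to 0. The many segments in between leave both functions unchanged.\<close>
theorem nontrivial_H1:
  "\<not> trivial_group (cohomology_group 1 X (additive_group :: 'k::comm_ring_1 monoid))"
proof -
  have "square (torus_act (length (cyclic_shift (d_seq ns) k)) c l) = square c"
    if "l \<in> (\<Pi>\<^sub>E r\<in>{..<length (cyclic_shift (d_seq ns) k)}. torus)" for c l
    using that square_torus_act by (simp add: length_d_seq)
  then obtain f where f: "continuous_map X euclidean f"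
    and "\<And>c. f (torus_orbit (length (cyclic_shift (d_seq ns) k)) c) = square c"
    using continuous_map_BS_one [OF continuous_map_square] by metis
  then have f_orbit: "f (torus_orbit m c) = square c" for c
    by (simp add: length_d_seq)
  have nz: "f x \<noteq> 0" if x: "x \<in> topspace X" for x
  proof -
    obtain c where c: "x = torus_orbit m c" "c \<in> topspace (BS_product (cyclic_shift (d_seq ns) k))"
        "matprod (map c [0..<m]) \<in> torus"
      using x unfolding topspace_BS_one length_cyclic_shift length_d_seq by blast
    show ?thesis
      using square_nonzero [OF c(2,3)] unfolding c(1) f_orbit .
  qed
  have last_lt: "1 \<le> n - 1" "n - 1 < n"
    using four by linarith+
  let ?up = "\<lambda>b \<theta>. rot_point (star_up b \<theta>) (chain_up b \<theta>) 0"
  let ?turn = "\<lambda>\<theta>. rot_point quarter (chain_turn \<theta>) \<theta>"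
  let ?down = "\<lambda>a \<theta>. rot_point (star_down a \<theta>) (chain_down a \<theta>) (pi / 2)"
  let ?last = "\<lambda>\<theta>. rot_point (star_down (n - 1) \<theta>) (\<lambda>_. 0) \<theta>"
  let ?bottom = "subtopology X {x. Im (f x) < 0}" and ?right = "subtopology X {x. Re (f x) > 0}"
    and ?top = "subtopology X {x. Im (f x) > 0}" and ?left = "subtopology X {x. Re (f x) < 0}"
  have up_next: "?up b (pi / 2) = ?up (Suc b) 0" for b
    by (intro rot_point_cong) (auto simp: star_up_def chain_up_def)
  have down_next: "?down a 0 = ?down (Suc a) (pi / 2)" for a
    by (intro rot_point_cong) (auto simp: star_down_def chain_down_def)
  have bottom: "path_component_of ?bottom (?up 1 0) (?up 1 (pi / 2))"
    using rot_point_path [OF f_orbit, where R = "{w. Im w < 0}" and s = "star_up 1" and p = "chain_up 1" and z = "\<lambda>_. 0"]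
      last_lt by (simp add: continuous_up matprod_up)
  have up: "path_component_of ?right (?up b 0) (?up b (pi / 2))" if "2 \<le> b" "b < n" for b
    using rot_point_path [OF f_orbit, where R = "{w. Re w > 0}" and s = "star_up b" and p = "chain_up b" and z = "\<lambda>_. 0"]
      that by (simp add: continuous_up matprod_up star_up_def [of b _ "Suc 0"])
  have up_all: "path_component_of ?right (?up 2 0) (?up b (pi / 2))" if "2 \<le> b" "b < n" for b
    using that
  proof (induction b rule: dec_induct)
    case base
    then show ?case using up by simp
  next
    case (step b)
    then show ?case
      using up [of "Suc b"] by (auto simp: up_next intro: path_component_of_trans)
  qed
  have turn: "path_component_of ?right (?turn 0) (?turn (pi / 2))"
    using rot_point_path [OF f_orbit, where R = "{w. Re w > 0}" and s = "\<lambda>_. quarter" and p = chain_turn and z = "\<lambda>\<theta>. \<theta>"]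
    by (simp add: continuous_turn matprod_turn)
  have up_turn: "?up (n - 1) (pi / 2) = ?turn 0"
    by (intro rot_point_cong) (auto simp: star_up_def chain_up_def chain_turn_def)
  have turn_down: "?turn (pi / 2) = ?down 1 (pi / 2)"
    by (intro rot_point_cong) (auto simp: star_down_def chain_down_def chain_turn_def)
  have "path_component_of ?right (?up 2 0) (?up (n - 1) (pi / 2))"
    using four by (intro up_all) auto
  then have right: "path_component_of ?right (?up 2 0) (?down 1 (pi / 2))"
    by (rule path_component_of_trans) (use turn in \<open>simp only: up_turn turn_down\<close>)
  have top: "path_component_of ?top (?down 1 (pi / 2)) (?down 1 0)"
    using rot_point_path [OF f_orbit, where R = "{w. Im w > 0}" and s = "star_down 1" and p = "chain_down 1" and z = "\<lambda>_. pi / 2"]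
      four by (simp add: continuous_down matprod_down)
  have down: "path_component_of ?left (?down a (pi / 2)) (?down a 0)" if "2 \<le> a" "Suc a < n" for a
    using rot_point_path [OF f_orbit, where R = "{w. Re w < 0}" and s = "star_down a" and p = "chain_down a" and z = "\<lambda>_. pi / 2"]
      that by (simp add: continuous_down matprod_down star_down_def [of a _ "Suc 0"])
  have down_all: "path_component_of ?left (?down 2 (pi / 2)) (?down a 0)" if "2 \<le> a" "Suc a < n" for a
    using that
  proof (induction a rule: dec_induct)
    case base
    then show ?case using down by simp
  next
    case (step a)
    then show ?case
      using down [of "Suc a"] by (auto simp: down_next intro: path_component_of_trans)
  qed
  have "star_down (n - 1) \<theta> 1 = 0" for \<theta>
    using four by (simp add: star_down_def)
  then have last: "path_component_of ?left (?last (pi / 2)) (?last 0)"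
    using rot_point_path [OF f_orbit, where R = "{w. Re w < 0}" and s = "star_down (n - 1)" and p = "\<lambda>_ _. 0" and z = "\<lambda>\<theta>. \<theta>"]
      matprod_last by (simp add: continuous_down)
  have down_last: "?down (n - 2) 0 = ?last (pi / 2)"
    using four by (intro rot_point_cong) (auto simp: star_down_def chain_down_def)
  have last_up: "?last 0 = ?up 1 0"
    by (intro rot_point_cong) (auto simp: star_down_def star_up_def chain_up_def)
  have "path_component_of ?left (?down 2 (pi / 2)) (?down (n - 2) 0)"
    using four by (intro down_all) auto
  then have left: "path_component_of ?left (?down 2 (pi / 2)) (?up 1 0)"
    by (rule path_component_of_trans) (use last in \<open>simp only: down_last last_up\<close>)
  show ?thesis
  proof (rule nontrivial_H1_if_circling [OF f nz bottom _ top])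
    show "path_component_of ?right (?up 1 (pi / 2)) (?down 1 (pi / 2))"
      using right up_next [of 1] by (simp only: Suc_1)
    show "path_component_of ?left (?down 1 0) (?up 1 0)"
      using left down_next [of 1] by (simp only: Suc_1)
  qed
qed

end

theorem corollary7p4p2:
  fixes ns :: "'n::{finite,linorder} list" and k :: int
  assumes "CARD('n) \<ge> 4"
    and "distinct ns" and "set ns = UNIV"
    and "CHAR('k::field) \<noteq> 2"
  shows "\<exists>j::int. \<not> trivial_group
    (cohomology_group (2 * j + 1) (BS_one (cyclic_shift (d_seq ns) k)) (additive_group :: 'k monoid))"
proof -
  have "length ns = CARD('n)"
    using assms(2,3) by (metis distinct_card)
  then interpret shifted_order ns k
    using assms by unfold_locales simp_all
  show ?thesis
    using nontrivial_H1 by (intro exI [of _ 0]) simp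
qed

end
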